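(* Let $\alpha\neq 0$ be a real number and let $\mathfrak{g}$ be the $3$-dimensional real Lie algebra with basis $z_1,z_2,z_3$ and brackets $[z_1,z_2]=0$, $[z_1,z_3]=z_1$, $[z_2,z_3]=\alpha z_2$ (so $\dim[\mathfrak{g},\mathfrak{g}]=2$). Put $\kappa=1$ if $\alpha=-1$ and $\kappa=0$ if $\alpha\neq-1$. Let $w>0$ be an integer. For the weight-$w$ chain complex $C_\bullet^{[w]}$ of the Lie superalgebra $\overline{\mathfrak{g}}$ associated with $\mathfrak{g}$, one has \[ \begin{array}{c|c|c|c} m & \dim C_m^{[w]} & \dim\ker(\partial:C_m^{[w]}\to C_{m-1}^{[w]}) & m\text{-th Betti number}\\\hline w-1 & \binom{w}{2} & \binom{w}{2} & 0\\ w & 3\binom{w}{2}+\binom{w+2}{2} & 2\binom{w}{2}+\binom{w+2}{2} & 0\\ w+1 & 3\binom{w}{2}+3\binom{w+2}{2} & \binom{w}{2}+2\binom{w+2}{2} & \kappa\\ w+2 & \binom{w}{2}+3\binom{w+2}{2} & \binom{w+2}{2}+\kappa & 2\kappa\\ w+3 & \binom{w+2}{2} & \kappa & \kappa \end{array} \]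
   Context: For a finite dimensional real Lie algebra $\mathfrak{g}$ of dimension $n$, let $\overline{\mathfrak{g}}=\bigoplus_{i=0}^{n-1}\mathfrak{g}_i$ with $\mathfrak{g}_i=\Lambda^{i+1}\mathfrak{g}$ (elements of $\mathfrak{g}_i$ have grade $i$). It is a $\mathbb{Z}$-graded Lie superalgebra with the Schouten-like bracket: for $a=a_1\wedge\cdots\wedge a_k$ and $b=b_1\wedge\cdots\wedge b_l$ with $a_i,b_j\in\mathfrak{g}$, \[ [a,b]_S=\sum_{i,j}(-1)^{i+j}[a_i,b_j]\wedge a[i]\wedge b[j], \] where $a[i]$ (resp. $b[j]$) is $a$ (resp. $b$) with the factor $a_i$ (resp. $b_j$) omitted. Chains: take the quotient of the tensor algebra of the vector space $\overline{\mathfrak{g}}$ by the two-sided ideal generated by $X\otimes Y+(-1)^{xy}Y\otimes X$ for $X\in\mathfrak{g}_x$, $Y\in\mathfrak{g}_y$; denote the induced product by $\bigtriangleup$. (So factors of odd grade commute with each other, and factors of even grade anticommute with all homogeneous factors.) The space $C_m$ of $m$-chains is the image of the $m$-fold tensors. The weight of $Y_1\bigtriangleup\cdots\bigtriangleup Y_m$ with $Y_i\in\mathfrak{g}_{y_i}$ is $y_1+\cdots+y_m$, and $C_m^{[w]}\subset C_m$ is the subspace of chains of weight $w$. The boundary operator $\partial:C_m\to C_{m-1}$ is \[ \partial(Y_1\bigtriangleup\cdots\bigtriangleup Y_m)=\sum_{i<j}(-1)^{\,i-1+y_i\sum_{i<s<j}y_s}\;Y_1\bigtriangleup\cdots\widehat{Y_i}\cdots\bigtriangleup[Y_i,Y_j]_S\bigtriangleup\cdots\bigtriangleup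 Y_m, \] where $Y_i$ is omitted and $[Y_i,Y_j]_S$ is placed in the position of $Y_j$. It preserves weight and satisfies $\partial\circ\partial=0$. The $m$-th Betti number in weight $w$ is $\dim\bigl(\ker(\partial:C_m^{[w]}\to C_{m-1}^{[w]})/\partial(C_{m+1}^{[w]})\bigr)$. By convention $\binom{1}{2}=0$. *)

theory Defs
  imports "HOL-Analysis.Analysis" "HOL-Analysis.Finite_Function_Topology"
begin

definition lie_bracket :: "('a::real_vector \<Rightarrow> 'a \<Rightarrow> 'a) \<Rightarrow> bool" where
  "lie_bracket br \<longleftrightarrow> bilinear br \<and> (\<forall>x. br x x = 0) \<and>
     (\<forall>x y z. br x (br y z) + br y (br z x) + br z (br x y) = 0)"

definition omit :: "nat \<Rightarrow> 'b list \<Rightarrow> 'b list" where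
  "omit i xs = take i xs @ drop (Suc i) xs"

definition word :: "'b list \<Rightarrow> ('b list \<Rightarrow>\<^sub>0 real)" where
  "word xs = Poly_Mapping.single xs 1"

text \<open>The free vector space on all words modulo the span of \<open>tensor_rel V\<close> is the tensor algebra of
  the subspace \<open>V\<close>: words with a letter outside \<open>V\<close> become zero, and words with letters in \<open>V\<close>
  become multilinear in their letters, with concatenation as the tensor product.\<close>

definition tensor_rel :: "'b::real_vector set \<Rightarrow> ('b list \<Rightarrow>\<^sub>0 real) set" where
  "tensor_rel V =
     {word xs | xs. \<not> set xs \<subseteq> V} \<union>
     {word (u @ (x + y) # v) - word (u @ x # v) - word (u @ y # v) | u v x y. x \<in> V \<and> y \<in> V} \<union>
     {word (u @ (c *\<^sub>R x) # v) - c *\<^sub>R word (u @ x # v) | u v c x. x \<in> V}"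

lemma equivp_mod_span: "equivp (\<lambda>p q. p - q \<in> span (A :: 'b::real_vector set))"
proof (intro equivpI reflpI sympI transpI)
  show "p - p \<in> span A" for p by (simp add: span_zero)
  show "q - p \<in> span A" if "p - q \<in> span A" for p q
    using span_neg[OF that] by simp
  show "p - r \<in> span A" if "p - q \<in> span A" "q - r \<in> span A" for p q r
    using span_add[OF that] by simp
qed

lemma mod_span_add:
  assumes "p - p' \<in> span A" "q - q' \<in> span (A :: 'b::real_vector set)"
  shows "(p + q) - (p' + q') \<in> span A"
  using span_add[OF assms] by (simp add: algebra_simps)

lemma mod_span_diff:
  assumes "p - p' \<in> span A" "q - q' \<in> span (A :: 'b::real_vector set)"
  shows "(p - q) - (p' - q') \<in> span A"
  using span_diff[OF assms] by (simp add: algebra_simps)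

lemma mod_span_uminus:
  assumes "p - p' \<in> span (A :: 'b::real_vector set)"
  shows "- p - (- p') \<in> span A"
  using span_neg[OF assms] by simp

lemma mod_span_scaleR:
  assumes "p - p' \<in> span (A :: 'b::real_vector set)"
  shows "c *\<^sub>R p - c *\<^sub>R p' \<in> span A"
  using span_scale[OF assms, of c] by (simp add: algebra_simps)

definition ext_rel :: "('a::real_vector list \<Rightarrow>\<^sub>0 real) set" where
  "ext_rel = span (tensor_rel UNIV \<union> {word (u @ x # x # v) | u x v. True})"

quotient_type (overloaded) 'a ext =
  "'a::real_vector list \<Rightarrow>\<^sub>0 real" / "\<lambda>p q. p - q \<in> ext_rel"
  unfolding ext_rel_def by (rule equivp_mod_span)

instantiation ext :: (real_vector) real_vector
begin

lift_definition zero_ext :: "'a ext" is 0 .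

lift_definition plus_ext :: "'a ext \<Rightarrow> 'a ext \<Rightarrow> 'a ext" is "(+)"
  unfolding ext_rel_def by (rule mod_span_add)

lift_definition minus_ext :: "'a ext \<Rightarrow> 'a ext \<Rightarrow> 'a ext" is "(-)"
  unfolding ext_rel_def by (rule mod_span_diff)

lift_definition uminus_ext :: "'a ext \<Rightarrow> 'a ext" is uminus
  unfolding ext_rel_def by (rule mod_span_uminus)

lift_definition scaleR_ext :: "real \<Rightarrow> 'a ext \<Rightarrow> 'a ext" is scaleR
  unfolding ext_rel_def by (rule mod_span_scaleR)

instance
  by standard (transfer, simp add: ext_rel_def span_zero algebra_simps)+

end

text \<open>\<open>wedge [a\<^sub>1, \<dots>, a\<^sub>k]\<close> is the product \<open>a\<^sub>1 \<and> \<dots> \<and> a\<^sub>k\<close>.\<close>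

definition wedge :: "'a::real_vector list \<Rightarrow> 'a ext" where
  "wedge as = abs_ext (word as)"

text \<open>\<open>grd i\<close> is the part of grade \<open>i\<close>, which is the exterior power of degree \<open>i + 1\<close>.  It is
  zero when \<open>i\<close> is at least the dimension, so no upper bound is imposed on \<open>i\<close>.\<close>

definition grd :: "nat \<Rightarrow> 'a::real_vector ext set" where
  "grd i = span {wedge as | as. length as = i + 1}"

definition gbar :: "'a::real_vector ext set" where
  "gbar = span (\<Union>i. grd i)"

text \<open>The bilinear map determined by its values on products of vectors.  List positions count
  from 0 on both sides, which leaves the parity of \<open>i + j\<close> unchanged.\<close>

definition schouten ::
    "('a::real_vector \<Rightarrow> 'a \<Rightarrow> 'a) \<Rightarrow> 'a ext \<Rightarrow> 'a ext \<Rightarrow> 'a ext" where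
  "schouten br = (THE S. bilinear S \<and>
     (\<forall>as bs. S (wedge as) (wedge bs) =
        (\<Sum>i<length as. \<Sum>j<length bs.
           (-1) ^ (i + j) *\<^sub>R wedge (br (as ! i) (bs ! j) # omit i as @ omit j bs))))"

definition chain_rel :: "('a::real_vector ext list \<Rightarrow>\<^sub>0 real) set" where
  "chain_rel = span (tensor_rel gbar \<union>
     {word (u @ X # Y # v) + (-1) ^ (x * y) *\<^sub>R word (u @ Y # X # v) | u v X Y x y.
        X \<in> grd x \<and> Y \<in> grd y})"

quotient_type (overloaded) 'a chain =
  "'a::real_vector ext list \<Rightarrow>\<^sub>0 real" / "\<lambda>p q. p - q \<in> chain_rel"
  unfolding chain_rel_def by (rule equivp_mod_span)

instantiation chain :: (real_vector) real_vector
begin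

lift_definition zero_chain :: "'a chain" is 0 .

lift_definition plus_chain :: "'a chain \<Rightarrow> 'a chain \<Rightarrow> 'a chain" is "(+)"
  unfolding chain_rel_def by (rule mod_span_add)

lift_definition minus_chain :: "'a chain \<Rightarrow> 'a chain \<Rightarrow> 'a chain" is "(-)"
  unfolding chain_rel_def by (rule mod_span_diff)

lift_definition uminus_chain :: "'a chain \<Rightarrow> 'a chain" is uminus
  unfolding chain_rel_def by (rule mod_span_uminus)

lift_definition scaleR_chain :: "real \<Rightarrow> 'a chain \<Rightarrow> 'a chain" is scaleR
  unfolding chain_rel_def by (rule mod_span_scaleR)

instance
  by standard (transfer, simp add: chain_rel_def span_zero algebra_simps)+

end

text \<open>\<open>tri [Y\<^sub>1, \<dots>, Y\<^sub>m]\<close> is the product \<open>Y\<^sub>1 \<triangle> \<dots> \<triangle> Y\<^sub>m\<close>.\<close>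

definition tri :: "'a::real_vector ext list \<Rightarrow> 'a chain" where
  "tri Ys = abs_chain (word Ys)"

definition has_grades :: "'a::real_vector ext list \<Rightarrow> nat list \<Rightarrow> bool" where
  "has_grades Ys ys \<longleftrightarrow> list_all2 (\<lambda>Y y. Y \<in> grd y) Ys ys"

definition chain_space :: "nat \<Rightarrow> nat \<Rightarrow> 'a::real_vector chain set" where
  "chain_space m w = span {tri Ys | Ys ys. length Ys = m \<and> has_grades Ys ys \<and> sum_list ys = w}"

text \<open>The linear map determined by its values on products of homogeneous elements.  As positions
  count from 0, the exponent \<open>i - 1\<close> of the usual formula reads \<open>i\<close> here.\<close>

definition boundary :: "('a::real_vector \<Rightarrow> 'a \<Rightarrow> 'a) \<Rightarrow> 'a chain \<Rightarrow> 'a chain" where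
  "boundary br = (THE D. linear D \<and>
     (\<forall>Ys ys. has_grades Ys ys \<longrightarrow>
        D (tri Ys) = (\<Sum>j<length Ys. \<Sum>i<j.
          (-1) ^ (i + ys ! i * (\<Sum>s\<in>{i<..<j}. ys ! s)) *\<^sub>R
            tri (omit i (Ys[j := schouten br (Ys ! i) (Ys ! j)])))))"

definition cycles :: "('a::real_vector \<Rightarrow> 'a \<Rightarrow> 'a) \<Rightarrow> nat \<Rightarrow> nat \<Rightarrow> 'a chain set" where
  "cycles br m w = {c \<in> chain_space m w. boundary br c = 0}"

text \<open>\<open>basis_mod V U B\<close>: the classes of the elements of \<open>B\<close> are pairwise distinct and form a basis of
  the quotient space \<open>V / U\<close>.\<close>

definition basis_mod :: "'v::real_vector set \<Rightarrow> 'v set \<Rightarrow> 'v set \<Rightarrow> bool" where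
  "basis_mod V U B \<longleftrightarrow> B \<subseteq> V \<and> V \<subseteq> span (B \<union> U) \<and>
     (\<forall>T c. finite T \<and> T \<subseteq> B \<and> (\<Sum>b\<in>T. c b *\<^sub>R b) \<in> U \<longrightarrow> (\<forall>b\<in>T. c b = 0))"

definition quot_dim :: "'v::real_vector set \<Rightarrow> 'v set \<Rightarrow> nat" where
  "quot_dim V U = card (SOME B. basis_mod V U B)"

definition betti :: "('a::real_vector \<Rightarrow> 'a \<Rightarrow> 'a) \<Rightarrow> nat \<Rightarrow> nat \<Rightarrow> nat" where
  "betti br m w = quot_dim (cycles br m w) (boundary br ` chain_space (m + 1) w)"

end

theory Submission
  imports Defs
begin

text \<open>
  Write \<open>u\<^sub>1 = z\<^sub>1 \<and> z\<^sub>2\<close>, \<open>u\<^sub>2 = z\<^sub>1 \<and> z\<^sub>3\<close>, \<open>u\<^sub>3 = z\<^sub>2 \<and> z\<^sub>3\<close> and \<open>v = z\<^sub>1 \<and> z\<^sub>2 \<and> z\<^sub>3\<close>.  These and the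
  \<open>z\<^sub>i\<close> form a homogeneous basis of the superalgebra, and the sign rule makes the chain space the
  tensor product of the exterior algebra on \<open>z\<^sub>3, z\<^sub>1, z\<^sub>2, v\<close> with the polynomial ring in
  \<open>u\<^sub>1, u\<^sub>2, u\<^sub>3\<close>.  So the ordered monomials in these letters are a basis of the chain space.  This
  is proved by letting the letters act on the free vector space over the monomials (\<open>mult\<close>): the
  resulting map \<open>phi\<close> and the evaluation \<open>psi\<close> of monomials are inverse to each other.  Counting
  monomials gives the dimensions of the chain spaces: the exponents of the \<open>u\<^sub>i\<close> add up to \<open>w\<close> if
  \<open>v\<close> is absent and to \<open>w - 2\<close> if \<open>v\<close> is present.

  The boundary operator is the linear map that kills the empty product and satisfies
  \<open>\<partial>(Y \<triangle> c) = ad\<^sub>Y c - Y \<triangle> \<partial>c\<close>, where \<open>ad\<^sub>Y\<close> is the superderivation extending \<open>[Y, _]\<close>.  In terms of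
  monomials this is an explicit operator \<open>bd\<close> with four terms.  The identity \<open>adj_mult\<close> says that
  \<open>bd Y + Y bd\<close> is such a superderivation, and the defining formula of \<open>\<partial>\<close> follows from it by
  induction on the number of factors.

  For the homology, note that \<open>\<partial>\<close> preserves the number \<open>p\<close> of factors \<open>z\<^sub>1\<close> and the number \<open>q\<close> of
  factors \<open>z\<^sub>2\<close> in a monomial, those inside \<open>u\<^sub>i\<close> and \<open>v\<close> included, and that \<open>ad z\<^sub>3\<close> multiplies such
  a monomial by \<open>-(p + \<alpha> q)\<close>.  As \<open>ad z\<^sub>3 = \<partial> z\<^sub>3 + z\<^sub>3 \<partial>\<close>, multiplication with \<open>z\<^sub>3\<close> contracts every
  part with \<open>p + \<alpha> q \<noteq> 0\<close>.  In positive weight, \<open>p + \<alpha> q = 0\<close> forces \<open>\<alpha> < 0\<close>, so \<open>1 - \<alpha> \<noteq> 0\<close> and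
  the term of \<open>\<partial>\<close> coming from \<open>[u\<^sub>2, u\<^sub>3] = (1 - \<alpha>) v\<close> cancels all monomials with \<open>v\<close> against all
  those without \<open>v\<close> that contain both \<open>u\<^sub>2\<close> and \<open>u\<^sub>3\<close>.  On the rest, the brackets
  \<open>[z\<^sub>2, u\<^sub>2] = \<alpha> u\<^sub>1\<close> and \<open>[z\<^sub>1, u\<^sub>3] = - u\<^sub>1\<close> cancel everything if \<open>p \<noteq> q\<close>; for \<open>\<alpha> = -1\<close>, where
  \<open>p = q\<close>, there remain the classes \<open>u\<^sub>1\<^sup>w\<^sup>-\<^sup>1(z\<^sub>1u\<^sub>3 - z\<^sub>2u\<^sub>2)\<close> in degree \<open>w + 1\<close>, \<open>z\<^sub>1z\<^sub>2u\<^sub>1\<^sup>w\<close> in degree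
  \<open>w + 2\<close>, and the products of both with \<open>z\<^sub>3\<close>.  The operator \<open>htpy\<close> collects these cancellations.
  It is not an exact homotopy, but \<open>defect = 1 - \<partial> htpy - htpy \<partial>\<close> is a chain map homotopic to the
  identity whose square has image in the span of the four classes, and this suffices
  (\<open>basis_mod_harm\<close>).

  There are no chains of degree \<open>w + 4\<close>, so the dimensions of the spaces of cycles follow from the
  homology and rank-nullity by descending through the degrees.
\<close>

section \<open>Linear maps on free vector spaces\<close>

definition lin_ext :: "('i \<Rightarrow> 'v::real_vector) \<Rightarrow> ('i \<Rightarrow>\<^sub>0 real) \<Rightarrow> 'v" where
  "lin_ext F p = (\<Sum>i\<in>Poly_Mapping.keys p. Poly_Mapping.lookup p i *\<^sub>R F i)"

lemma lookup_scaleR [simp]: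
  "Poly_Mapping.lookup (c *\<^sub>R p) i = c *\<^sub>R Poly_Mapping.lookup (p :: 'i \<Rightarrow>\<^sub>0 real) i"
proof -
  have "finite {i. c *\<^sub>R Poly_Mapping.lookup p i \<noteq> 0}"
    by (rule finite_subset[OF _ finite_lookup[of p]]) auto
  then show ?thesis
    by (simp add: scaleR_poly_mapping_def)
qed

lemma lin_ext_superset:
  assumes "finite S" "Poly_Mapping.keys p \<subseteq> S"
  shows "lin_ext F p = (\<Sum>i\<in>S. Poly_Mapping.lookup p i *\<^sub>R F i)"
  unfolding lin_ext_def using assms
  by (intro sum.mono_neutral_left) (auto simp: in_keys_iff)

lemma linear_lin_ext: "linear (lin_ext F)"
proof (rule linearI)
  fix p q :: "'a \<Rightarrow>\<^sub>0 real" and c :: real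
  let ?S = "Poly_Mapping.keys p \<union> Poly_Mapping.keys q"
  have "lin_ext F (p + q) = (\<Sum>i\<in>?S. Poly_Mapping.lookup (p + q) i *\<^sub>R F i)"
    by (rule lin_ext_superset) (auto simp: keys_add)
  moreover have "lin_ext F p = (\<Sum>i\<in>?S. Poly_Mapping.lookup p i *\<^sub>R F i)"
    "lin_ext F q = (\<Sum>i\<in>?S. Poly_Mapping.lookup q i *\<^sub>R F i)"
    by (rule lin_ext_superset; auto)+
  ultimately show "lin_ext F (p + q) = lin_ext F p + lin_ext F q"
    by (simp add: lookup_add scaleR_left_distrib sum.distrib)
  have "lin_ext F (c *\<^sub>R p) = (\<Sum>i\<in>Poly_Mapping.keys p. Poly_Mapping.lookup (c *\<^sub>R p) i *\<^sub>R F i)"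
    by (rule lin_ext_superset) (auto simp: in_keys_iff)
  then show "lin_ext F (c *\<^sub>R p) = c *\<^sub>R lin_ext F p"
    by (simp add: lin_ext_def scaleR_sum_right)
qed

abbreviation unit_vec :: "'i \<Rightarrow> 'i \<Rightarrow>\<^sub>0 real" where
  "unit_vec i \<equiv> Poly_Mapping.single i 1"

lemma lin_ext_unit_vec [simp]: "lin_ext F (unit_vec i) = F i"
  by (simp add: lin_ext_def)

lemmas lin_ext_simps [simp] =
  linear_add[OF linear_lin_ext] linear_diff[OF linear_lin_ext] linear_scale[OF linear_lin_ext]
  linear_0[OF linear_lin_ext]

lemma lin_ext_unit_vec_id: "lin_ext unit_vec p = p"
proof (rule poly_mapping_eqI)
  fix k
  have "Poly_Mapping.lookup (lin_ext unit_vec p) k =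
    (\<Sum>i\<in>Poly_Mapping.keys p. if i = k then Poly_Mapping.lookup p i else 0)"
    unfolding lin_ext_def lookup_sum by (intro sum.cong) (auto simp: lookup_single when_def)
  also have "\<dots> = Poly_Mapping.lookup p k"
    by (simp add: in_keys_iff)
  finally show "Poly_Mapping.lookup (lin_ext unit_vec p) k = Poly_Mapping.lookup p k" .
qed

lemma in_span_unit_vec:
  assumes "Poly_Mapping.keys p \<subseteq> I"
  shows "p \<in> span (unit_vec ` I)"
proof -
  have "lin_ext unit_vec p \<in> span (unit_vec ` I)"
    unfolding lin_ext_def using assms by (intro span_sum span_scale span_base) auto
  then show ?thesis by (simp add: lin_ext_unit_vec_id)
qed

lemma linear_eq_on_unit_vec:
  assumes "linear f" "linear g" "\<And>i. f (unit_vec i) = g (unit_vec i)"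
  shows "f p = g p"
  by (rule linear_eq_on[OF assms(1,2) in_span_unit_vec[OF subset_UNIV]]) (use assms(3) in auto)

lemma unit_vec_eq_iff [simp]: "unit_vec i = unit_vec j \<longleftrightarrow> i = j"
  by (metis lookup_single_eq lookup_single_not_eq zero_neq_one)

lemma independent_unit_vec: "independent (unit_vec ` I)"
proof (subst independent_explicit_finite_subsets, intro allI impI ballI)
  fix S :: "('a \<Rightarrow>\<^sub>0 real) set" and u v
  assume S: "S \<subseteq> unit_vec ` I" "finite S" and 0: "(\<Sum>v\<in>S. u v *\<^sub>R v) = 0" and v: "v \<in> S"
  from S v obtain i where i: "v = unit_vec i" by auto
  have "0 = Poly_Mapping.lookup (\<Sum>v\<in>S. u v *\<^sub>R v) i" by (simp add: 0)
  also have "\<dots> = (\<Sum>x\<in>S. if x = v then u x else 0)"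
    unfolding lookup_sum
  proof (intro sum.cong refl)
    fix x assume "x \<in> S"
    then obtain j where "x = unit_vec j" using S(1) by auto
    then show "Poly_Mapping.lookup (u x *\<^sub>R x) i = (if x = v then u x else 0)"
      by (simp add: lookup_single when_def i)
  qed
  also have "\<dots> = u v" using v S(2) by simp
  finally show "u v = 0" by simp
qed

lemma dim_span_unit_vec: "dim (span (unit_vec ` I)) = card I"
  by (subst dim_span_eq_card_independent[OF independent_unit_vec]) (rule card_image, rule inj_onI, simp)

section \<open>Dimensions of quotients and of kernels\<close>

text \<open>Completing a basis of \<open>V / U\<close> by one of \<open>U\<close> reduces every statement about \<open>basis_mod\<close> to ordinary
  bases.\<close>

lemma basis_mod_Un_basis:
  fixes U V B A :: "'v::real_vector set"
  assumes B: "basis_mod V U B" and A: "A \<subseteq> U" "independent A" "U \<subseteq> span A"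
    and U: "subspace U" "U \<subseteq> V"
  shows "independent (B \<union> A)" "B \<inter> A = {}" "V \<subseteq> span (B \<union> A)"
proof -
  have mod: "\<And>T c. finite T \<Longrightarrow> T \<subseteq> B \<Longrightarrow> (\<Sum>b\<in>T. c b *\<^sub>R b) \<in> U \<Longrightarrow> \<forall>b\<in>T. c b = (0::real)"
    using B unfolding basis_mod_def by blast
  have "False" if "b \<in> B" "b \<in> A" for b
    using mod[of "{b}" "\<lambda>_. 1"] that A(1) by auto
  then show disj: "B \<inter> A = {}" by blast
  have "span (B \<union> U) \<subseteq> span (B \<union> A)"
    by (rule span_minimal) (use A span_mono[of A "B \<union> A"] span_superset[of "B \<union> A"] in auto)
  then show "V \<subseteq> span (B \<union> A)"
    using B unfolding basis_mod_def by blast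
  show "independent (B \<union> A)"
  proof (subst independent_explicit_finite_subsets, intro allI impI)
    fix S and u :: "'v \<Rightarrow> real"
    assume S: "S \<subseteq> B \<union> A" "finite S" and 0: "(\<Sum>v\<in>S. u v *\<^sub>R v) = 0"
    have split: "(\<Sum>v\<in>S. u v *\<^sub>R v) = (\<Sum>v\<in>S \<inter> B. u v *\<^sub>R v) + (\<Sum>v\<in>S \<inter> A. u v *\<^sub>R v)"
      using S disj by (subst sum.union_disjoint[symmetric]) (auto intro!: sum.cong)
    have SA: "(\<Sum>v\<in>S \<inter> A. u v *\<^sub>R v) \<in> U"
      using A(1) U(1) by (intro subspace_sum subspace_scale) auto
    have "(\<Sum>v\<in>S \<inter> B. u v *\<^sub>R v) = - (\<Sum>v\<in>S \<inter> A. u v *\<^sub>R v)"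
      using 0 split by (simp add: add_eq_0_iff2)
    then have "(\<Sum>v\<in>S \<inter> B. u v *\<^sub>R v) \<in> U"
      using SA subspace_neg[OF U(1)] by simp
    then have uB: "\<forall>v\<in>S \<inter> B. u v = 0"
      using mod[of "S \<inter> B" u] S(2) by auto
    then have "(\<Sum>v\<in>S \<inter> A. u v *\<^sub>R v) = 0"
      using 0 split by simp
    then have "\<forall>v\<in>S \<inter> A. u v = 0"
      using A(2) S(2) unfolding independent_explicit_finite_subsets by (meson finite_Int inf_le2)
    then show "\<forall>v\<in>S. u v = 0" using uB S(1) by blast
  qed
qed

lemma card_basis_mod:
  fixes U V F :: "'v::real_vector set"
  assumes "basis_mod V U B" "subspace U" "subspace V" "U \<subseteq> V" "V \<subseteq> span F" "finite F"
  shows "finite B" "dim V = dim U + card B"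
proof -
  obtain A where A: "A \<subseteq> U" "independent A" "U \<subseteq> span A" "card A = dim U"
    using basis_exists[of U] by metis
  note BA = basis_mod_Un_basis[OF assms(1) A(1-3) assms(2,4)]
  have "B \<union> A \<subseteq> span F"
    using assms A(1) unfolding basis_mod_def by blast
  then have fin: "finite (B \<union> A)"
    using independent_span_bound[OF assms(6) BA(1)] by blast
  then show "finite B" by simp
  have "dim V = card (B \<union> A)"
    by (rule dim_unique[OF _ BA(3,1) refl])
      (use assms(1,4) A(1) in \<open>auto simp: basis_mod_def\<close>)
  then show "dim V = dim U + card B"
    using card_Un_disjoint[of B A] fin BA(2) A(4) by simp
qed

text \<open>Only with an existing basis does the choice in the definition of \<open>quot_dim\<close> refer to anything.\<close>

lemma basis_mod_exists:
  fixes U V :: "'v::real_vector set"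
  assumes "subspace U" "U \<subseteq> V"
  shows "\<exists>B. basis_mod V U B"
proof -
  obtain A where A: "A \<subseteq> U" "independent A" "U \<subseteq> span A"
    using basis_exists[of U] by metis
  obtain C where C: "A \<subseteq> C" "C \<subseteq> V" "independent C" "V \<subseteq> span C"
    using maximal_independent_subset_extend[of A V] A assms(2) by (metis order_trans)
  have spanA: "span A = U"
    using A assms(1) by (metis span_eq_iff span_mono subset_antisym)
  have "basis_mod V U (C - A)"
    unfolding basis_mod_def
  proof (intro conjI allI impI)
    show "C - A \<subseteq> V" using C by blast
    show "V \<subseteq> span (C - A \<union> U)"
      using C(4) A(1) span_mono[of C "C - A \<union> U"] by blast
  next
    fix T and c :: "'v \<Rightarrow> real"
    assume T: "finite T \<and> T \<subseteq> C - A \<and> (\<Sum>b\<in>T. c b *\<^sub>R b) \<in> U"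
    then have "(\<Sum>b\<in>T. c b *\<^sub>R b) \<in> span A" using spanA by simp
    then obtain S d where S: "finite S" "S \<subseteq> A" "(\<Sum>b\<in>T. c b *\<^sub>R b) = (\<Sum>a\<in>S. d a *\<^sub>R a)"
      unfolding span_explicit by blast
    define e where "e v = (if v \<in> T then c v else - d v)" for v
    have dj: "T \<inter> S = {}" using T S by blast
    have "(\<Sum>v\<in>T \<union> S. e v *\<^sub>R v) = (\<Sum>v\<in>T. e v *\<^sub>R v) + (\<Sum>v\<in>S. e v *\<^sub>R v)"
      using T S dj by (simp add: sum.union_disjoint)
    also have "(\<Sum>v\<in>T. e v *\<^sub>R v) = (\<Sum>v\<in>T. c v *\<^sub>R v)"
      by (simp add: e_def)
    also have "(\<Sum>v\<in>S. e v *\<^sub>R v) = (\<Sum>v\<in>S. - (d v *\<^sub>R v))"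
      by (rule sum.cong) (use dj in \<open>auto simp: e_def\<close>)
    finally have "(\<Sum>v\<in>T \<union> S. e v *\<^sub>R v) = 0"
      using S(3) by (simp add: sum_negf)
    moreover have "T \<union> S \<subseteq> C" "finite (T \<union> S)" using T S C by auto
    ultimately have "\<forall>v\<in>T \<union> S. e v = 0"
      using C(3) unfolding independent_explicit_finite_subsets by blast
    then show "\<forall>b\<in>T. c b = 0" by (metis UnCI e_def)
  qed
  then show ?thesis ..
qed

lemma dim_eq_quot_dim:
  fixes U V F :: "'v::real_vector set"
  assumes "subspace U" "subspace V" "U \<subseteq> V" "V \<subseteq> span F" "finite F"
  shows "dim V = dim U + quot_dim V U"
  unfolding quot_dim_def
  by (rule card_basis_mod(2)[OF someI_ex[OF basis_mod_exists] assms]) (use assms in auto)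

text \<open>A basis of \<open>V\<close> modulo the kernel is mapped bijectively to a basis of the image.\<close>

lemma rank_nullity:
  fixes f :: "'v::real_vector \<Rightarrow> 'w::real_vector"
  assumes f: "linear f" and V: "subspace V" "V \<subseteq> span F" "finite F"
  shows "dim V = dim {v \<in> V. f v = 0} + dim (f ` V)"
proof -
  let ?K = "{v \<in> V. f v = 0}"
  have K: "subspace ?K" "?K \<subseteq> V"
    using V(1) by (auto simp: subspace_def linear_0[OF f] linear_add[OF f] linear_scale[OF f])
  obtain B where B: "basis_mod V ?K B"
    using basis_mod_exists[OF K] by blast
  note card = card_basis_mod[OF B K(1) V(1) K(2) V(2,3)]
  have BV: "B \<subseteq> V" and spans: "V \<subseteq> span (B \<union> ?K)" using B by (auto simp: basis_mod_def)
  have zero: "\<forall>b\<in>T. c b = 0" if "T \<subseteq> B" "(\<Sum>b\<in>T. c b *\<^sub>R f b) = 0" for T and c :: "'v \<Rightarrow> real"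
  proof -
    have "finite T" using that(1) card(1) finite_subset by blast
    moreover have "(\<Sum>b\<in>T. c b *\<^sub>R b) \<in> ?K"
      using that BV V(1) by (auto simp: linear_sum[OF f] linear_scale[OF f] intro!: subspace_sum subspace_scale)
    ultimately show ?thesis using B that(1) unfolding basis_mod_def by blast
  qed
  have inj: "inj_on f B"
  proof (rule inj_onI, rule ccontr)
    fix x y assume xy: "x \<in> B" "y \<in> B" "f x = f y" "x \<noteq> y"
    show False
      using zero[of "{x, y}" "\<lambda>v. if v = x then 1 else -1"] xy by auto
  qed
  have "independent (f ` B)"
  proof (subst independent_explicit_finite_subsets, intro allI impI)
    fix S and u :: "'w \<Rightarrow> real"
    assume S: "S \<subseteq> f ` B" "finite S" "(\<Sum>v\<in>S. u v *\<^sub>R v) = 0"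
    then obtain T where T: "T \<subseteq> B" "S = f ` T" by (meson subset_imageE)
    have "inj_on f T" using inj T(1) inj_on_subset by blast
    then have "(\<Sum>b\<in>T. u (f b) *\<^sub>R f b) = 0"
      using S(3) T(2) by (simp add: sum.reindex)
    then show "\<forall>v\<in>S. u v = 0" using zero[OF T(1), of "\<lambda>b. u (f b)"] T(2) by auto
  qed
  moreover have "f ` V \<subseteq> span (f ` B)"
  proof -
    have "f ` V \<subseteq> span (f ` (B \<union> ?K))"
      using spans linear_span_image[OF f, of "B \<union> ?K"] by blast
    also have "\<dots> \<subseteq> span (f ` B)"
      by (rule span_minimal) (auto simp: span_zero intro: span_base)
    finally show ?thesis .
  qed
  ultimately have "dim (f ` V) = card (f ` B)"
    by (intro dim_unique[of "f ` B"]) (use BV in auto)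
  then show ?thesis using card(2) card_image[OF inj] by simp
qed

lemma dim_inj_linear_image:
  fixes f :: "'v::real_vector \<Rightarrow> 'w::real_vector"
  assumes f: "linear f" and inj: "inj f"
  shows "dim (f ` V) = dim V"
proof -
  obtain B where B: "B \<subseteq> V" "independent B" "V \<subseteq> span B" "card B = dim V"
    using basis_exists[of V] by metis
  have "dim (f ` V) = card (f ` B)"
  proof (rule dim_unique)
    show "f ` V \<subseteq> span (f ` B)" using B(3) linear_span_image[OF f, of B] by blast
    show "independent (f ` B)" by (rule linear_independent_injective_image[OF f B(2) inj_on_subset[OF inj]]) simp
  qed (use B in auto)
  then show ?thesis using B(4) card_image[OF inj_on_subset[OF inj, of B]] by simp
qed

section \<open>A coordinate model of the chain complex\<close>

text \<open>Used to write out small integral multiples as repeated sums, so that linear combinations of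
  monomials can be compared by cancellation alone.\<close>

lemma scaleR_numeral_Bit:
  "numeral (num.Bit0 k) *\<^sub>R x = numeral k *\<^sub>R x + numeral k *\<^sub>R x"
  "numeral (num.Bit1 k) *\<^sub>R x = numeral k *\<^sub>R x + numeral k *\<^sub>R x + x"
  "(y * numeral (num.Bit0 k)) *\<^sub>R x = (y * numeral k) *\<^sub>R x + (y * numeral k) *\<^sub>R x"
  "(y * numeral (num.Bit1 k)) *\<^sub>R x = (y * numeral k) *\<^sub>R x + (y * numeral k) *\<^sub>R x + y *\<^sub>R x"
  "(y * (z * numeral (num.Bit0 k))) *\<^sub>R x = (y * (z * numeral k)) *\<^sub>R x + (y * (z * numeral k)) *\<^sub>R x"
  "(y * (z * numeral (num.Bit1 k))) *\<^sub>R x = (y * (z * numeral k)) *\<^sub>R x + (y * (z * numeral k)) *\<^sub>R x + (y * z) *\<^sub>R x"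
  for x :: "'a :: real_vector"
  by (simp_all only: numeral.simps scaleR_left_distrib scaleR_one distrib_left mult_1_right)

text \<open>The homogeneous basis of the superalgebra: \<open>U1\<close>, \<open>U2\<close>, \<open>U3\<close> stand for \<open>z\<^sub>1 \<and> z\<^sub>2\<close>, \<open>z\<^sub>1 \<and> z\<^sub>3\<close>,
  \<open>z\<^sub>2 \<and> z\<^sub>3\<close>, and \<open>V\<close> for \<open>z\<^sub>1 \<and> z\<^sub>2 \<and> z\<^sub>3\<close>.\<close>

datatype letter = Z3 | Z1 | Z2 | V | U1 | U2 | U3

text \<open>\<open>Cell r p q e a b c\<close> is the monomial \<open>z\<^sub>3\<^sup>r z\<^sub>1\<^sup>p z\<^sub>2\<^sup>q v\<^sup>e u\<^sub>1\<^sup>a u\<^sub>2\<^sup>b u\<^sub>3\<^sup>c\<close>.  The letters of even grade anticommute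
  with everything, so their exponents are truth values.  Putting \<open>z\<^sub>3\<close> first makes the homotopy for
  \<open>ad z\<^sub>3\<close> free of signs.\<close>

datatype cell = Cell bool bool bool bool nat nat nat

abbreviation cvec :: "bool \<Rightarrow> bool \<Rightarrow> bool \<Rightarrow> bool \<Rightarrow> nat \<Rightarrow> nat \<Rightarrow> nat \<Rightarrow> cell \<Rightarrow>\<^sub>0 real" where
  "cvec r p q e a b c \<equiv> unit_vec (Cell r p q e a b c)"

text \<open>The sign for moving a letter past a factor of even grade that may be present or absent.\<close>

definition par :: "bool \<Rightarrow> real" where
  "par x = (if x then - 1 else 1)"

lemma par_simps [simp]: "par True = - 1" "par False = 1"
  by (simp_all add: par_def)

fun grade :: "letter \<Rightarrow> nat" where
  "grade Z3 = 0" | "grade Z1 = 0" | "grade Z2 = 0" | "grade V = 2"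
| "grade U1 = 1" | "grade U2 = 1" | "grade U3 = 1"

text \<open>Multiplication from the left, sorted into the normal order of \<open>Cell\<close>.\<close>

fun mult_cell :: "letter \<Rightarrow> cell \<Rightarrow> (cell \<Rightarrow>\<^sub>0 real)" where
  "mult_cell Z3 (Cell r p q e a b c) = (if r then 0 else cvec True p q e a b c)"
| "mult_cell Z1 (Cell r p q e a b c) = (if p then 0 else par r *\<^sub>R cvec r True q e a b c)"
| "mult_cell Z2 (Cell r p q e a b c) = (if q then 0 else (par r * par p) *\<^sub>R cvec r p True e a b c)"
| "mult_cell V (Cell r p q e a b c) =
    (if e then 0 else (par r * par p * par q) *\<^sub>R cvec r p q True a b c)"
| "mult_cell U1 (Cell r p q e a b c) = (par r * par p * par q * par e) *\<^sub>R cvec r p q e (Suc a) b c"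
| "mult_cell U2 (Cell r p q e a b c) = (par r * par p * par q * par e) *\<^sub>R cvec r p q e a (Suc b) c"
| "mult_cell U3 (Cell r p q e a b c) = (par r * par p * par q * par e) *\<^sub>R cvec r p q e a b (Suc c)"

definition mult :: "letter \<Rightarrow> (cell \<Rightarrow>\<^sub>0 real) \<Rightarrow> (cell \<Rightarrow>\<^sub>0 real)" where
  "mult l = lin_ext (mult_cell l)"

lemma linear_mult: "linear (mult l)"
  unfolding mult_def by (rule linear_lin_ext)

lemmas mult_simps [simp] =
  linear_add[OF linear_mult] linear_diff[OF linear_mult] linear_scale[OF linear_mult]
  linear_neg[OF linear_mult] linear_0[OF linear_mult]

lemma mult_unit_vec [simp]: "mult l (unit_vec i) = mult_cell l i"
  by (simp add: mult_def)

lemma mult_commute_sign: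
  "mult l (mult l' x) = - ((- 1) ^ (grade l * grade l')) *\<^sub>R mult l' (mult l x)"
proof (rule linear_eq_on_unit_vec[where p = x])
  show "linear (\<lambda>x. mult l (mult l' x))"
    "linear (\<lambda>x. - ((- 1) ^ (grade l * grade l')) *\<^sub>R mult l' (mult l x))"
    by (rule linearI; simp add: algebra_simps)+
  fix i show "mult l (mult l' (unit_vec i)) =
    - ((- 1) ^ (grade l * grade l')) *\<^sub>R mult l' (mult l (unit_vec i))"
    by (cases i; cases l; cases l'; simp add: par_def)
qed

text \<open>\<open>fst_weight\<close> and \<open>snd_weight\<close> count the factors \<open>z\<^sub>1\<close> and \<open>z\<^sub>2\<close> of a monomial, inside the \<open>u\<^sub>i\<close> and
  \<open>v\<close> as well.\<close>

fun fst_weight snd_weight weight degree :: "cell \<Rightarrow> nat" where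
  "fst_weight (Cell r p q e a b c) = of_bool p + of_bool e + a + b"
| "snd_weight (Cell r p q e a b c) = of_bool q + of_bool e + a + c"
| "weight (Cell r p q e a b c) = 2 * of_bool e + a + b + c"
| "degree (Cell r p q e a b c) = of_bool r + of_bool p + of_bool q + of_bool e + a + b + c"

locale model =
  fixes \<alpha> :: real
  assumes \<alpha>_nonzero: "\<alpha> \<noteq> 0"
begin

text \<open>The negative of the eigenvalue of \<open>ad z\<^sub>3\<close>.\<close>

definition eig :: "cell \<Rightarrow> real" where
  "eig i = real (fst_weight i) + \<alpha> * real (snd_weight i)"

text \<open>The four terms come from \<open>ad z\<^sub>3\<close>, from \<open>[z\<^sub>1, u\<^sub>3] = - u\<^sub>1\<close>, from \<open>[z\<^sub>2, u\<^sub>2] = \<alpha> u\<^sub>1\<close> and from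
  \<open>[u\<^sub>2, u\<^sub>3] = (1 - \<alpha>) v\<close>.  A truncated exponent \<open>c - 1\<close> or \<open>b - 1\<close> only occurs with coefficient zero.\<close>

fun bd_cell :: "cell \<Rightarrow> (cell \<Rightarrow>\<^sub>0 real)" where
  "bd_cell (Cell r p q e a b c) =
     (if r then - eig (Cell r p q e a b c) *\<^sub>R cvec False p q e a b c else 0)
   + (if p then - (par r * real c) *\<^sub>R cvec r False q e (Suc a) b (c - 1) else 0)
   + (if q then (par r * par p * \<alpha> * real b) *\<^sub>R cvec r p False e (Suc a) (b - 1) c else 0)
   + (if e then 0
      else (par r * par p * par q * (1 - \<alpha>) * real b * real c) *\<^sub>R cvec r p q True a (b - 1) (c - 1))"

definition bd :: "(cell \<Rightarrow>\<^sub>0 real) \<Rightarrow> (cell \<Rightarrow>\<^sub>0 real)" where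
  "bd = lin_ext bd_cell"

lemma linear_bd: "linear bd"
  unfolding bd_def by (rule linear_lin_ext)

lemmas bd_simps [simp] =
  linear_add[OF linear_bd] linear_diff[OF linear_bd] linear_scale[OF linear_bd]
  linear_neg[OF linear_bd] linear_0[OF linear_bd]

lemma bd_unit_vec [simp]: "bd (unit_vec i) = bd_cell i"
  by (simp add: bd_def)

lemma bd_bd: "bd (bd x) = 0"
proof (rule linear_eq_on_unit_vec[where p = x])
  show "linear (\<lambda>x. bd (bd x))" by (rule linearI) simp_all
  fix i show "bd (bd (unit_vec i)) = 0"
  proof (cases i)
    case (Cell r p q e a b c)
    show ?thesis unfolding Cell
      by (cases b; cases c; cases r; cases p; cases q; cases e; simp add: eig_def algebra_simps)
  qed
qed (rule linearI; simp)

text \<open>Every bracket of two basis letters is a multiple of a single letter.  \<open>br_coeff\<close> is the multiple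
  and \<open>br_letter\<close> the letter, chosen arbitrarily when the multiple is zero.\<close>

fun br_coeff :: "letter \<Rightarrow> letter \<Rightarrow> real" where
  "br_coeff Z1 Z3 = 1" | "br_coeff Z3 Z1 = - 1"
| "br_coeff Z2 Z3 = \<alpha>" | "br_coeff Z3 Z2 = - \<alpha>"
| "br_coeff Z1 U3 = - 1" | "br_coeff U3 Z1 = 1"
| "br_coeff Z2 U2 = \<alpha>" | "br_coeff U2 Z2 = - \<alpha>"
| "br_coeff Z3 U1 = - (1 + \<alpha>)" | "br_coeff U1 Z3 = 1 + \<alpha>"
| "br_coeff Z3 U2 = - 1" | "br_coeff U2 Z3 = 1"
| "br_coeff Z3 U3 = - \<alpha>" | "br_coeff U3 Z3 = \<alpha>"
| "br_coeff Z3 V = - (1 + \<alpha>)" | "br_coeff V Z3 = 1 + \<alpha>"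
| "br_coeff U2 U3 = 1 - \<alpha>" | "br_coeff U3 U2 = 1 - \<alpha>"
| "br_coeff _ _ = 0"

fun br_letter :: "letter \<Rightarrow> letter \<Rightarrow> letter" where
  "br_letter Z1 U3 = U1" | "br_letter U3 Z1 = U1"
| "br_letter Z2 U2 = U1" | "br_letter U2 Z2 = U1"
| "br_letter U2 U3 = V" | "br_letter U3 U2 = V"
| "br_letter Z3 l = l" | "br_letter l _ = l"

text \<open>The adjoint action on chains.  It is defined through \<open>bd\<close>, so that the recursion
  \<open>bd (Y c) = ad\<^sub>Y c - Y bd c\<close> holds by definition; the content is in the derivation rule below.\<close>

definition adj :: "letter \<Rightarrow> (cell \<Rightarrow>\<^sub>0 real) \<Rightarrow> (cell \<Rightarrow>\<^sub>0 real)" where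
  "adj l x = bd (mult l x) + mult l (bd x)"

lemma linear_adj: "linear (adj l)"
  by (rule linearI) (simp_all add: adj_def algebra_simps)

lemma adj_mult_unit_vec:
  "adj l (mult l' (unit_vec i)) = br_coeff l l' *\<^sub>R mult (br_letter l l') (unit_vec i)
     + (- 1) ^ (grade l * grade l') *\<^sub>R mult l' (adj l (unit_vec i))"
proof (cases i)
  case (Cell r p q e a b c)
  show ?thesis
  proof (cases l)
    case Z3
    show ?thesis unfolding Cell adj_def Z3
      by (cases l'; cases b; cases c)
        (simp_all add: eig_def algebra_simps par_def scaleR_numeral_Bit)
  next
    case Z1
    show ?thesis unfolding Cell adj_def Z1
      by (cases l'; cases b; cases c)
        (simp_all add: eig_def algebra_simps par_def scaleR_numeral_Bit)
  next
    case Z2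
    show ?thesis unfolding Cell adj_def Z2
      by (cases l'; cases b; cases c)
        (simp_all add: eig_def algebra_simps par_def scaleR_numeral_Bit)
  next
    case V
    show ?thesis unfolding Cell adj_def V
      by (cases l'; cases b; cases c)
        (simp_all add: eig_def algebra_simps par_def scaleR_numeral_Bit)
  next
    case U1
    show ?thesis unfolding Cell adj_def U1
      by (cases l'; cases b; cases c)
        (simp_all add: eig_def algebra_simps par_def scaleR_numeral_Bit)
  next
    case U2
    show ?thesis unfolding Cell adj_def U2
      by (cases l'; cases b; cases c)
        (simp_all add: eig_def algebra_simps par_def scaleR_numeral_Bit)
  next
    case U3
    show ?thesis unfolding Cell adj_def U3
      by (cases l'; cases b; cases c)
        (simp_all add: eig_def algebra_simps par_def scaleR_numeral_Bit)
  qed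
qed

text \<open>\<open>adj l\<close> is a superderivation extending the bracket.  Together with the vanishing of
  \<open>bd\<close> and \<open>adj l\<close> on the empty product this determines \<open>bd\<close>.\<close>

lemma adj_mult:
  "adj l (mult l' x) = br_coeff l l' *\<^sub>R mult (br_letter l l') x
     + (- 1) ^ (grade l * grade l') *\<^sub>R mult l' (adj l x)"
proof (rule linear_eq_on_unit_vec[where p = x])
  show "linear (\<lambda>x. adj l (mult l' x))"
    by (rule linearI) (simp_all add: adj_def algebra_simps)
  show "linear (\<lambda>x. br_coeff l l' *\<^sub>R mult (br_letter l l') x
     + (- 1) ^ (grade l * grade l') *\<^sub>R mult l' (adj l x))"
    by (rule linearI) (simp_all add: adj_def algebra_simps)
qed (rule adj_mult_unit_vec)

end

section \<open>The monomials of given degree and weight\<close>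

definition cells :: "nat \<Rightarrow> nat \<Rightarrow> cell set" where
  "cells m w = {i. degree i = m \<and> weight i = w}"

definition chains :: "nat \<Rightarrow> nat \<Rightarrow> (cell \<Rightarrow>\<^sub>0 real) set" where
  "chains m w = span (unit_vec ` cells m w)"

definition exponents :: "nat \<Rightarrow> (nat \<times> nat \<times> nat) set" where
  "exponents n = {(a, b, c). a + b + c = n}"

definition bits :: "nat \<Rightarrow> (bool \<times> bool \<times> bool) set" where
  "bits k = {(r, p, q). of_bool r + of_bool p + of_bool q = k}"

text \<open>Monomials sorted by the presence of \<open>v\<close>, the number of factors \<open>z\<^sub>i\<close> and the total exponent of the
  \<open>u\<^sub>i\<close>.\<close>

definition block :: "bool \<Rightarrow> nat \<Rightarrow> nat \<Rightarrow> cell set" where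
  "block e k n = (\<lambda>((r, p, q), (a, b, c)). Cell r p q e a b c) ` (bits k \<times> exponents n)"

text \<open>Once \<open>a\<close> and \<open>b\<close> are chosen, \<open>c\<close> is determined; this gives a triangular number.\<close>

lemma card_exponents: "card (exponents n) = (n + 2) choose 2"
proof -
  let ?T = "SIGMA a : {..n}. {..n - a}"
  have "bij_betw (\<lambda>(a, b). (a, b, n - a - b)) ?T (exponents n)"
    unfolding exponents_def by (rule bij_betwI[where g = "\<lambda>(a, b, c). (a, b)"]) auto
  then have "card (exponents n) = card ?T"
    by (simp add: bij_betw_same_card)
  also have "\<dots> = (\<Sum>a\<le>n. Suc (n - a))" by simp
  also have "\<dots> = (\<Sum>a\<le>n. Suc a)"
    by (rule sum.reindex_bij_witness[of _ "\<lambda>a. n - a" "\<lambda>a. n - a"]) auto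
  also have "\<dots> = (n + 2) choose 2"
    by (induction n) (simp_all add: numeral_2_eq_2)
  finally show ?thesis .
qed

lemma finite_exponents: "finite (exponents n)"
  by (rule finite_subset[of _ "{..n} \<times> {..n} \<times> {..n}"]) (auto simp: exponents_def)

lemma card_bits: "card (bits k) = 3 choose k"
proof -
  let ?B = "bits k"
  consider "k = 0" | "k = 1" | "k = 2" | "k = 3" | "k > 3" by linarith
  then show ?thesis
  proof cases
    case 1
    then have "?B = {(False, False, False)}" by (auto simp: bits_def split: if_splits)
    then show ?thesis using 1 by simp
  next
    case 2
    then have "?B = {(True, False, False), (False, True, False), (False, False, True)}"
      by (auto simp: bits_def of_bool_def split: if_splits)
    then show ?thesis using 2 by simp
  next
    case 3
    then have "?B = {(True, True, False), (True, False, True), (False, True, True)}"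
      by (auto simp: bits_def of_bool_def split: if_splits)
    then show ?thesis using 3 by (simp add: numeral_2_eq_2 numeral_3_eq_3)
  next
    case 4
    then have "?B = {(True, True, True)}" by (auto simp: bits_def of_bool_def split: if_splits)
    then show ?thesis using 4 by simp
  next
    case 5
    then have "?B = {}" by (auto simp: bits_def of_bool_def split: if_splits)
    then show ?thesis using 5 by (simp add: binomial_eq_0)
  qed
qed

lemma Cell_in_block [simp]:
  "Cell r p q e' a b c \<in> block e k n \<longleftrightarrow>
     e' = e \<and> of_bool r + of_bool p + of_bool q = k \<and> a + b + c = n"
proof -
  have "Cell r p q e' a b c \<in> block e k n \<longleftrightarrow> e' = e \<and> (r, p, q) \<in> bits k \<and> (a, b, c) \<in> exponents n"
    unfolding block_def by force
  then show ?thesis by (simp add: bits_def exponents_def)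
qed

lemma card_block: "card (block e k n) = (3 choose k) * ((n + 2) choose 2)"
proof -
  have "inj_on (\<lambda>((r, p, q), (a, b, c)). Cell r p q e a b c) (bits k \<times> exponents n)"
    by (rule inj_onI) auto
  then show ?thesis
    unfolding block_def by (simp only: card_image card_cartesian_product card_bits card_exponents)
qed

lemma finite_block: "finite (block e k n)"
  unfolding block_def by (intro finite_imageI finite_cartesian_product finite_exponents) simp

text \<open>A monomial without \<open>v\<close> has \<open>w\<close> factors \<open>u\<^sub>i\<close>, one with \<open>v\<close> has \<open>w - 2\<close> of them; the degree then
  fixes the number of factors \<open>z\<^sub>i\<close>.  The shifted parameter \<open>k = m + 1 - w\<close> is a natural number in all
  degrees where chains exist.\<close>

lemma card_cells:
  assumes "Suc m = w + k"
  shows "card (cells m w) =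
    (if k = 0 then 0 else 3 choose (k - 1)) * ((w + 2) choose 2) + (3 choose k) * (w choose 2)"
proof -
  \<comment> \<open>\<open>?N\<close> consists of the monomials without \<open>v\<close>, \<open>?V\<close> of those with \<open>v\<close>; the weight 1 leaves no room for \<open>v\<close>.\<close>
  let ?N = "if k = 0 then {} else block False (k - 1) w"
  let ?V = "if w < 2 then {} else block True k (w - 2)"
  have "i \<in> cells m w \<longleftrightarrow> i \<in> ?N \<union> ?V" for i
  proof (cases i)
    case (Cell r p q e a b c)
    define s t where "s = (of_bool r + of_bool p + of_bool q :: nat)" and "t = a + b + c"
    have deg: "degree (Cell r p q e a b c) = s + of_bool e + t"
      and wt: "weight (Cell r p q e a b c) = 2 * of_bool e + t"
      by (simp_all add: s_def t_def)
    show ?thesis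
    proof (cases e)
      case True
      have "i \<in> cells m w \<longleftrightarrow> t + 2 = w \<and> s = k"
        using assms unfolding Cell cells_def mem_Collect_eq deg wt by (auto simp: True)
      then show ?thesis by (auto simp: Cell True s_def[symmetric] t_def[symmetric])
    next
      case False
      have "i \<in> cells m w \<longleftrightarrow> t = w \<and> s + 1 = k"
        using assms unfolding Cell cells_def mem_Collect_eq deg wt by (auto simp: False)
      then show ?thesis by (cases k) (auto simp: Cell False s_def[symmetric] t_def[symmetric])
    qed
  qed
  then have eq: "cells m w = ?N \<union> ?V" by blast
  have fin: "finite ?N" "finite ?V" by (simp_all add: finite_block)
  have "card ?N = (if k = 0 then 0 else 3 choose (k - 1)) * ((w + 2) choose 2)"
    by (simp add: card_block)
  moreover have "card ?V = (3 choose k) * (w choose 2)"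
  proof (cases "w < 2")
    case False
    then have "w - 2 + 2 = w" by simp
    with False show ?thesis by (simp add: card_block)
  qed (simp add: binomial_eq_0)
  moreover have "i \<notin> ?N \<inter> ?V" for i
    by (cases i) auto
  then have "?N \<inter> ?V = {}" by blast
  ultimately show ?thesis
    unfolding eq using fin by (simp only: card_Un_disjoint)
qed

lemma finite_cells: "finite (cells m w)"
proof -
  have "i \<in> (\<lambda>((r, p, q, e), a, b, c). Cell r p q e a b c) ` (UNIV \<times> {..w} \<times> {..w} \<times> {..w})"
    if "i \<in> cells m w" for i
  proof (cases i)
    case (Cell r p q e a b c)
    with that have "a \<le> w" "b \<le> w" "c \<le> w" by (auto simp: cells_def)
    then show ?thesis unfolding Cell by (intro image_eqI[of _ _ "((r, p, q, e), a, b, c)"]) auto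
  qed
  then have "cells m w \<subseteq> (\<lambda>((r, p, q, e), a, b, c). Cell r p q e a b c) ` (UNIV \<times> {..w} \<times> {..w} \<times> {..w})"
    by blast
  then show ?thesis by (rule finite_subset) (intro finite_imageI finite_cartesian_product finite_UNIV; simp)
qed

lemma dim_chains: "dim (chains m w) = card (cells m w)"
  by (simp add: chains_def dim_span_unit_vec del: dim_span)

lemma linear_image_span_subset:
  assumes "linear f" "\<And>x. x \<in> S \<Longrightarrow> f x \<in> span T" "x \<in> span S"
  shows "f x \<in> span T"
  using linear_span_image[OF assms(1), of S] span_minimal[of "f ` S" "span T"] assms(2,3) by auto

text \<open>A system with a pivot coordinate for each member is in echelon form.\<close>

lemma independent_pivots:
  fixes S :: "('i \<Rightarrow>\<^sub>0 real) set"
  assumes pivot: "\<And>h. h \<in> S \<Longrightarrow> \<exists>i. Poly_Mapping.lookup h i = 1 \<and> (\<forall>h'\<in>S - {h}. Poly_Mapping.lookup h' i = 0)"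
  shows "independent S"
proof (subst independent_explicit_finite_subsets, intro allI impI ballI)
  fix T u h
  assume T: "T \<subseteq> S" "finite T" and 0: "(\<Sum>v\<in>T. u v *\<^sub>R v) = 0" and h: "h \<in> T"
  obtain i where i: "Poly_Mapping.lookup h i = 1" "\<forall>h'\<in>S - {h}. Poly_Mapping.lookup h' i = 0"
    using pivot[of h] T h by blast
  have "0 = Poly_Mapping.lookup (\<Sum>v\<in>T. u v *\<^sub>R v) i" by (simp add: 0)
  also have "\<dots> = (\<Sum>v\<in>T. if v = h then u v else 0)"
    unfolding lookup_sum using i T(1) by (intro sum.cong) auto
  also have "\<dots> = u h" using h T(2) by simp
  finally show "u h = 0" by simp
qed

section \<open>Homology of the model\<close>

context model
begin

text \<open>A partial inverse of \<open>bd\<close> on monomials.  Where \<open>ad z\<^sub>3\<close> is invertible, it is multiplication with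
  \<open>z\<^sub>3\<close> divided by the eigenvalue.  Elsewhere it inverts, up to a sign for moving past \<open>z\<^sub>3\<close>, one chosen
  term of \<open>bd\<close>: the one from \<open>[u\<^sub>2, u\<^sub>3]\<close> if \<open>v\<close> is present, and on monomials without \<open>v\<close> the one from
  \<open>[z\<^sub>2, u\<^sub>2]\<close> or the one from \<open>[z\<^sub>1, u\<^sub>3]\<close>.  Which of the two is right depends on \<open>\<alpha>\<close>: where
  \<open>eig\<close> vanishes, \<open>\<alpha> \<le> -1\<close> makes \<open>fst_weight\<close> at least as large as \<open>snd_weight\<close>, and then
  a monomial with neither \<open>v\<close> nor \<open>u\<^sub>2\<close> contains at most one \<open>u\<^sub>3\<close>; for \<open>\<alpha> > -1\<close> the roles are exchanged.\<close>

fun htpy_cell :: "cell \<Rightarrow> (cell \<Rightarrow>\<^sub>0 real)" where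
  "htpy_cell (Cell r p q e a b c) =
    (if eig (Cell r p q e a b c) \<noteq> 0 then
       (if r then 0 else - (1 / eig (Cell r p q e a b c)) *\<^sub>R cvec True p q e a b c)
     else if e then
       (par r * par p * par q / ((1 - \<alpha>) * real (Suc b) * real (Suc c))) *\<^sub>R
          cvec r p q False a (Suc b) (Suc c)
     else if \<alpha> \<le> - 1 then
       (if \<not> q \<and> c = 0 \<and> a > 0 then
          (par r * par p / (\<alpha> * real (Suc b))) *\<^sub>R cvec r p True False (a - 1) (Suc b) 0 else 0)
     else
       (if \<not> p \<and> b = 0 \<and> a > 0 then
          - (par r / real (Suc c)) *\<^sub>R cvec r True q False (a - 1) 0 (Suc c) else 0))"

definition htpy :: "(cell \<Rightarrow>\<^sub>0 real) \<Rightarrow> (cell \<Rightarrow>\<^sub>0 real)" where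
  "htpy = lin_ext htpy_cell"

lemma linear_htpy: "linear htpy"
  unfolding htpy_def by (rule linear_lin_ext)

lemmas htpy_simps [simp] =
  linear_add[OF linear_htpy] linear_diff[OF linear_htpy] linear_scale[OF linear_htpy]
  linear_neg[OF linear_htpy] linear_0[OF linear_htpy]

lemma htpy_unit_vec [simp]: "htpy (unit_vec i) = htpy_cell i"
  by (simp add: htpy_def)

text \<open>This would be zero if \<open>htpy\<close> were a contracting homotopy.  Where \<open>ad z\<^sub>3\<close> vanishes, the choices made in
  \<open>htpy\<close> do not fit together perfectly: the defect of a monomial is a combination of monomials without
  \<open>v\<close> that lack \<open>u\<^sub>2\<close> or \<open>u\<^sub>3\<close>.  On those the fit is perfect up to homology classes.\<close>

definition defect :: "(cell \<Rightarrow>\<^sub>0 real) \<Rightarrow> (cell \<Rightarrow>\<^sub>0 real)" where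
  "defect x = x - bd (htpy x) - htpy (bd x)"

lemma defect_simps [simp]:
  "defect (x + y) = defect x + defect y" "defect (x - y) = defect x - defect y"
  "defect (k *\<^sub>R x) = k *\<^sub>R defect x" "defect (- x) = - defect x" "defect 0 = 0"
  by (simp_all add: defect_def algebra_simps)


lemma eig_cong: "fst_weight i = fst_weight j \<Longrightarrow> snd_weight i = snd_weight j \<Longrightarrow> eig i = eig j"
  by (simp add: eig_def)

text \<open>This is \<open>bd z\<^sub>3 + z\<^sub>3 bd = ad z\<^sub>3\<close>, where \<open>ad z\<^sub>3\<close> is a nonzero scalar.\<close>

lemma defect_eig_nonzero:
  assumes "eig i \<noteq> 0"
  shows "defect (unit_vec i) = 0"
proof (cases i)
  case (Cell r p q e a b c)
  define t where "t = eig i"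
  have t: "t \<noteq> 0" using assms by (simp add: t_def)
  have z: "eig j = t"
    if "fst_weight j = fst_weight (Cell r p q e a b c)" "snd_weight j = snd_weight (Cell r p q e a b c)" for j
    unfolding t_def using that Cell by (intro eig_cong) auto
  show ?thesis using t unfolding Cell
    by (cases b; cases c; cases r; cases p; cases q; cases e)
      (simp_all add: z defect_def algebra_simps)
qed

text \<open>With \<open>p\<close> and \<open>q\<close> the two weights, \<open>p = - \<alpha> q\<close>, and \<open>p\<close>, \<open>q\<close> do not both vanish in positive weight.\<close>

lemma weights_of_eig_zero:
  assumes "eig i = 0" "weight i > 0"
  shows "\<alpha> < 0" "fst_weight i > 0" "snd_weight i > 0"
    "\<alpha> < - 1 \<Longrightarrow> snd_weight i < fst_weight i"
    "\<alpha> = - 1 \<Longrightarrow> snd_weight i = fst_weight i"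
    "- 1 < \<alpha> \<Longrightarrow> fst_weight i < snd_weight i"
proof -
  let ?P = "fst_weight i" and ?Q = "snd_weight i"
  have eq: "real ?P = - \<alpha> * real ?Q" using assms(1) by (simp add: eig_def)
  have "?P + ?Q > 0" using assms(2) by (cases i) auto
  then have Q: "?Q > 0" using eq by (cases "?Q = 0") auto
  then show "?Q > 0" .
  have P: "?P > 0"
  proof (rule ccontr)
    assume "\<not> ?P > 0"
    then have "\<alpha> * real ?Q = 0" using eq by simp
    then show False using Q \<alpha>_nonzero by simp
  qed
  then show "?P > 0" .
  have "- \<alpha> * real ?Q > 0" using P eq by linarith
  then show "\<alpha> < 0" using Q by (simp add: mult_less_0_iff)
  show "?Q < ?P" if "\<alpha> < - 1"
    using mult_strict_right_mono[of 1 "- \<alpha>" "real ?Q"] that Q eq by simp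
  show "?Q = ?P" if "\<alpha> = - 1" using that eq by simp
  show "?P < ?Q" if "- 1 < \<alpha>"
    using mult_strict_right_mono[of "- \<alpha>" 1 "real ?Q"] that Q eq by simp
qed

text \<open>The homotopy that restores a factor \<open>u\<^sub>2 u\<^sub>3\<close> from \<open>v\<close> commutes, up to sign, with the two terms that
  lower the exponent of \<open>u\<^sub>3\<close> or \<open>u\<^sub>2\<close>, unless that exponent is zero: then one of the two compositions
  vanishes and the other one is left over.  The result is free of \<open>v\<close> and lacks \<open>u\<^sub>2\<close> or \<open>u\<^sub>3\<close>.\<close>

lemma defect_with_V:
  assumes "eig (Cell r p q True a b c) = 0" "\<alpha> < 0"
  shows "defect (cvec r p q True a b c) =
    (if p \<and> c = 0 then (- par q / ((1 - \<alpha>) * real (Suc b))) *\<^sub>R cvec r False q False (Suc a) (Suc b) 0 else 0)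
  + (if q \<and> b = 0 then (\<alpha> / ((1 - \<alpha>) * real (Suc c))) *\<^sub>R cvec r p False False (Suc a) 0 (Suc c) else 0)"
proof -
  have z: "eig j = 0"
    if "fst_weight j = fst_weight (Cell r p q True a b c)" "snd_weight j = snd_weight (Cell r p q True a b c)" for j
    unfolding assms(1)[symmetric] using that by (intro eig_cong) auto
  \<comment> \<open>An opaque name keeps the simplifier from multiplying out the denominators.\<close>
  define \<delta> where "\<delta> = 1 - \<alpha>"
  have nz: "\<delta> \<noteq> 0" "\<alpha> \<noteq> 0" using assms(2) by (simp_all add: \<delta>_def)
  have one: "real (Suc 0) = 1" by simp
  show ?thesis using nz
    by (cases b; cases c; cases r; cases p; cases q)
      (simp_all add: z defect_def \<delta>_def[symmetric] one scaleR_right_distrib scaleR_right_diff_distrib del: of_nat_Suc)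
qed

text \<open>The term from \<open>[u\<^sub>2, u\<^sub>3]\<close> and its inverse cancel the monomial itself.  A leftover arises if one of
  the other two terms removes the last \<open>u\<^sub>2\<close> or \<open>u\<^sub>3\<close>.\<close>

lemma defect_no_V:
  assumes "eig (Cell r p q False a (Suc b) (Suc c)) = 0" "\<alpha> < 0"
  shows "defect (cvec r p q False a (Suc b) (Suc c)) =
    (if \<alpha> \<le> - 1 \<and> p \<and> \<not> q \<and> c = 0
     then (1 / (\<alpha> * real (Suc (Suc b)))) *\<^sub>R cvec r False True False a (Suc (Suc b)) 0 else 0)
  + (if \<not> \<alpha> \<le> - 1 \<and> \<not> p \<and> q \<and> b = 0
     then (\<alpha> / real (Suc (Suc c))) *\<^sub>R cvec r True False False a 0 (Suc (Suc c)) else 0)"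
proof -
  have z: "eig j = 0"
    if "fst_weight j = fst_weight (Cell r p q False a (Suc b) (Suc c))" "snd_weight j = snd_weight (Cell r p q False a (Suc b) (Suc c))" for j
    unfolding assms(1)[symmetric] using that by (intro eig_cong) auto
  \<comment> \<open>An opaque name keeps the simplifier from multiplying out the denominators.\<close>
  define \<delta> where "\<delta> = 1 - \<alpha>"
  have nz: "\<delta> \<noteq> 0" "\<alpha> \<noteq> 0" using assms(2) by (simp_all add: \<delta>_def)
  have one: "real (Suc 0) = 1" by simp
  show ?thesis using nz
    by (cases b; cases c; cases r; cases p; cases q)
      (simp_all add: z defect_def \<delta>_def[symmetric] one scaleR_right_distrib scaleR_right_diff_distrib del: of_nat_Suc)
qed


text \<open>On monomials without \<open>v\<close> and without \<open>u\<^sub>2\<close> or \<open>u\<^sub>3\<close> at most one of the terms \<open>[z\<^sub>2, u\<^sub>2]\<close> and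
  \<open>[z\<^sub>1, u\<^sub>3]\<close> can act, and the inequality between the two weights makes it the one that \<open>htpy\<close>
  inverts.  The exceptions require equality of the weights.\<close>

lemma defect_flat:
  assumes eig: "eig (Cell r p q False a b c) = 0" and wt: "weight (Cell r p q False a b c) > 0"
    and flat: "b = 0 \<or> c = 0"
  shows "defect (cvec r p q False a b c) =
    (if \<alpha> = - 1 \<and> p \<and> \<not> q \<and> b = 0 \<and> c = 1 then cvec r True False False a 0 1 - cvec r False True False a 1 0
     else if \<alpha> = - 1 \<and> p \<and> q \<and> b = 0 \<and> c = 0 then cvec r True True False a 0 0 else 0)"
proof -
  have z: "eig j = 0"
    if "fst_weight j = fst_weight (Cell r p q False a b c)" "snd_weight j = snd_weight (Cell r p q False a b c)" for j
    unfolding eig[symmetric] using that by (intro eig_cong) auto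
  have one: "real (Suc 0) = 1" by simp
  note w = weights_of_eig_zero[OF eig wt]
  consider "\<alpha> < -1" | "\<alpha> = - 1" | "- 1 < \<alpha>" by linarith
  then show ?thesis
  proof cases
    case 1
    then show ?thesis using w flat
      by (cases a; cases b; cases c; cases r; cases p; cases q)
        (simp_all add: z defect_def one scaleR_right_distrib scaleR_right_diff_distrib del: of_nat_Suc)
  next
    case 2
    then have \<alpha>: "(\<alpha> = - 1) = True" "(\<alpha> \<le> - 1) = True" "1 / \<alpha> = - 1"
        "\<And>x :: cell \<Rightarrow>\<^sub>0 real. \<alpha> *\<^sub>R x = - x" by simp_all
    have "snd_weight (Cell r p q False a b c) = fst_weight (Cell r p q False a b c)" using w(5) 2 .
    then show ?thesis using w(2,3) flat
      by (cases a; cases b; cases c; cases r; cases p; cases q)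
        (simp_all add: \<alpha> one z defect_def scaleR_right_distrib scaleR_right_diff_distrib del: of_nat_Suc)
  next
    case 3
    then show ?thesis using w flat
      by (cases a; cases b; cases c; cases r; cases p; cases q)
        (simp_all add: z defect_def one scaleR_right_distrib scaleR_right_diff_distrib del: of_nat_Suc)
  qed
qed


lemma unit_vec_in_chains: "degree i = m \<Longrightarrow> weight i = w \<Longrightarrow> unit_vec i \<in> chains m w"
  by (auto simp: chains_def cells_def intro: span_base)

lemma subspace_chains: "subspace (chains m w)"
  by (simp add: chains_def)

lemma scaled_unit_vec_in_chains:
  "(t \<noteq> 0 \<Longrightarrow> degree i = m \<and> weight i = w) \<Longrightarrow> t *\<^sub>R unit_vec i \<in> chains m w"
  by (cases "t = 0") (auto simp: subspace_0 subspace_chains intro!: subspace_scale[OF subspace_chains] unit_vec_in_chains)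

lemma if_in_chains:
  "(P \<Longrightarrow> x \<in> chains m w) \<Longrightarrow> (\<not> P \<Longrightarrow> y \<in> chains m w) \<Longrightarrow> (if P then x else y) \<in> chains m w"
  by simp

lemmas chains_intros = subspace_add[OF subspace_chains] subspace_0[OF subspace_chains]
  scaled_unit_vec_in_chains if_in_chains

lemma bd_chains: "x \<in> chains (Suc m) w \<Longrightarrow> bd x \<in> chains m w"
  unfolding chains_def
proof (rule linear_image_span_subset[OF linear_bd])
  fix y assume "y \<in> unit_vec ` cells (Suc m) w"
  then obtain i where i: "y = unit_vec i" "degree i = Suc m" "weight i = w" by (auto simp: cells_def)
  show "bd y \<in> span (unit_vec ` cells m w)"
  proof (cases i)
    case (Cell r p q e a b c)
    show ?thesis using i(2,3) unfolding i(1) Cell chains_def[symmetric] bd_unit_vec bd_cell.simps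
      by (intro chains_intros) auto
  qed
qed

lemma htpy_chains: "x \<in> chains m w \<Longrightarrow> htpy x \<in> chains (Suc m) w"
  unfolding chains_def
proof (rule linear_image_span_subset[OF linear_htpy])
  fix y assume "y \<in> unit_vec ` cells m w"
  then obtain i where i: "y = unit_vec i" "degree i = m" "weight i = w" by (auto simp: cells_def)
  show "htpy y \<in> span (unit_vec ` cells (Suc m) w)"
  proof (cases i)
    case (Cell r p q e a b c)
    show ?thesis using i(2,3) unfolding i(1) Cell chains_def[symmetric] htpy_unit_vec htpy_cell.simps
      by (intro chains_intros) auto
  qed
qed

lemma linear_defect: "linear defect"
  by (rule linearI) simp_all

lemma bd_defect: "bd (defect x) = defect (bd x)"
  by (simp add: defect_def bd_bd)

definition harm_low :: "bool \<Rightarrow> nat \<Rightarrow> cell \<Rightarrow>\<^sub>0 real" where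
  "harm_low r k = cvec r True False False k 0 1 - cvec r False True False k 1 0"

definition harm_high :: "bool \<Rightarrow> nat \<Rightarrow> cell \<Rightarrow>\<^sub>0 real" where
  "harm_high r k = cvec r True True False k 0 0"

text \<open>The representatives of the homology classes: two families, each without and with the factor \<open>z\<^sub>3\<close>.\<close>

definition harm :: "nat \<Rightarrow> nat \<Rightarrow> (cell \<Rightarrow>\<^sub>0 real) set" where
  "harm m w = (if \<alpha> \<noteq> - 1 then {} else
    {harm_low r k | r k. m = of_bool r + w + 1 \<and> w = Suc k} \<union>
    {harm_high r w | r. m = of_bool r + w + 2})"

lemma harm_properties:
  assumes "h \<in> harm m w" "w > 0"
  shows "h \<in> chains m w" "bd h = 0" "defect h = h"
proof -
  have al: "\<alpha> = - 1" using assms(1) by (simp add: harm_def split: if_splits)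
  have eig0: "eig (Cell r True False False k 0 1) = 0" "eig (Cell r False True False k 1 0) = 0"
    "eig (Cell r True True False k 0 0) = 0" for r k
    unfolding eig_def using al by simp_all
  have al': "(\<alpha> = - 1) = True" "\<And>x :: cell \<Rightarrow>\<^sub>0 real. \<alpha> *\<^sub>R x = - x" using al by simp_all
  consider r k where "h = harm_low r k" "m = of_bool r + w + 1" "w = Suc k"
    | r where "h = harm_high r w" "m = of_bool r + w + 2"
    using assms(1) by (auto simp: harm_def split: if_splits)
  then have "h \<in> chains m w \<and> bd h = 0 \<and> defect h = h"
  proof cases
    case 1
    have "bd h = 0" unfolding 1 harm_low_def
      using eig0[of r k] by (cases r) (simp_all add: al')
    moreover have "defect h = h" unfolding 1 harm_low_def
      using defect_flat[OF eig0(1)[of r k]] defect_flat[OF eig0(2)[of r k]] by (simp add: al')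
    ultimately show ?thesis using 1
      by (auto simp: harm_low_def intro!: subspace_diff[OF subspace_chains] unit_vec_in_chains)
  next
    case 2
    have "bd h = 0" unfolding 2 harm_high_def
      using eig0(3)[of r w] by (cases r) (simp_all add: al')
    moreover have "defect h = h" unfolding 2 harm_high_def
      using defect_flat[OF eig0(3)[of r w]] assms(2) by (simp add: al')
    ultimately show ?thesis using 2
      by (auto simp: harm_high_def intro!: unit_vec_in_chains)
  qed
  then show "h \<in> chains m w" "bd h = 0" "defect h = h" by simp_all
qed

lemma defect_flat_in_harm:
  assumes "eig (Cell r p q False a b c) = 0" "weight (Cell r p q False a b c) = w" "w > 0"
    and "degree (Cell r p q False a b c) = m" "b = 0 \<or> c = 0"
  shows "defect (cvec r p q False a b c) \<in> span (harm m w)"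
proof -
  have "harm_low r a \<in> harm m w" if c: "\<alpha> = - 1 \<and> p \<and> \<not> q \<and> b = 0 \<and> c = 1"
  proof -
    have "m = of_bool r + w + 1" "w = Suc a" using assms(2,4) c by auto
    then show ?thesis unfolding harm_def if_not_P[OF not_not[THEN iffD2, OF conjunct1[OF c]]] by blast
  qed
  moreover have "harm_high r a \<in> harm m w" if c: "\<alpha> = - 1 \<and> p \<and> q \<and> b = 0 \<and> c = 0"
  proof -
    have "m = of_bool r + w + 2" "a = w" using assms(2,4) c by auto
    then show ?thesis unfolding harm_def if_not_P[OF not_not[THEN iffD2, OF conjunct1[OF c]]] by blast
  qed
  moreover note defect_flat[OF assms(1) _ assms(5), unfolded assms(2), OF assms(3)]
  ultimately show ?thesis
    unfolding harm_low_def harm_high_def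
    by (simp only: split: if_split) (blast intro: span_base span_zero)
qed

text \<open>The first application of the defect ends in monomials without \<open>v\<close> and without \<open>u\<^sub>2\<close> or \<open>u\<^sub>3\<close>, the
  second one in the span of the representatives.\<close>

lemma defect_defect_in_harm:
  assumes "x \<in> chains m w" "w > 0"
  shows "defect (defect x) \<in> span (harm m w)"
  using assms(1) unfolding chains_def
proof (rule linear_image_span_subset[rotated 2])
  show "linear (\<lambda>x. defect (defect x))" by (rule linearI) simp_all
  fix y assume "y \<in> unit_vec ` cells m w"
  then obtain i where i: "y = unit_vec i" "degree i = m" "weight i = w" by (auto simp: cells_def)
  show "defect (defect y) \<in> span (harm m w)"
  proof (cases "eig i = 0")
    case False
    then show ?thesis by (simp add: i(1) defect_eig_nonzero span_zero)
  next
    case True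
    have neg: "\<alpha> < 0" using weights_of_eig_zero(1)[OF True] i(3) assms(2) by simp
    obtain r p q e a b c where Cell: "i = Cell r p q e a b c" by (cases i)
    have z: "eig j = 0" if "fst_weight j = fst_weight (Cell r p q e a b c)"
      "snd_weight j = snd_weight (Cell r p q e a b c)" for j
      using True that Cell eig_cong[of j i] by simp
    have flat: "defect (cvec r' p' q' False a' b' c') \<in> span (harm m w)"
      if "fst_weight (Cell r' p' q' False a' b' c') = fst_weight (Cell r p q e a b c)"
        "snd_weight (Cell r' p' q' False a' b' c') = snd_weight (Cell r p q e a b c)"
        "weight (Cell r' p' q' False a' b' c') = weight (Cell r p q e a b c)"
        "degree (Cell r' p' q' False a' b' c') = degree (Cell r p q e a b c)" "b' = 0 \<or> c' = 0"
      for r' p' q' a' b' c'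
      using that i(2,3) assms(2) Cell by (intro defect_flat_in_harm z) auto
    consider "e" | "\<not> e" "b = 0 \<or> c = 0" | b' c' where "\<not> e" "b = Suc b'" "c = Suc c'"
      by (cases b; cases c) auto
    then show ?thesis
    proof cases
      case 1
      then show ?thesis
        using True neg flat unfolding i(1) Cell
        by (auto simp: defect_with_V intro!: span_add span_neg span_scale span_zero)
    next
      case 2
      have fix_harm: "defect h = h" if "h \<in> span (harm m w)" for h
        by (rule linear_eq_on[OF linear_defect linear_id[unfolded id_def] that])
          (use harm_properties(3) assms(2) in auto)
      have "defect y \<in> span (harm m w)"
        using 2 flat[of r p q a b c] unfolding i(1) Cell by auto
      then show ?thesis by (simp add: fix_harm)
    next
      case 3
      then show ?thesis
        using True neg flat unfolding i(1) Cell
        by (auto simp: defect_no_V intro!: span_add span_neg span_scale span_zero)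
    qed
  qed
qed

lemma independent_harm: "independent (harm m w)"
proof (rule independent_pivots)
  fix h assume h: "h \<in> harm m w"
  then consider r k where "h = harm_low r k" "m = of_bool r + w + 1" "w = Suc k"
    | r where "h = harm_high r w" "m = of_bool r + w + 2"
    by (auto simp: harm_def split: if_splits)
  then show "\<exists>i. Poly_Mapping.lookup h i = 1 \<and> (\<forall>h'\<in>harm m w - {h}. Poly_Mapping.lookup h' i = 0)"
  proof cases
    case 1
    show ?thesis
      by (rule exI[of _ "Cell r True False False k 0 1"])
        (auto simp: 1 harm_def harm_low_def harm_high_def lookup_minus lookup_single when_def split: if_splits)
  next
    case 2
    show ?thesis
      by (rule exI[of _ "Cell r True True False w 0 0"])
        (auto simp: 2 harm_def harm_low_def harm_high_def lookup_minus lookup_single when_def split: if_splits)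
  qed
qed

text \<open>Let \<open>N\<close> be the defect.  A cycle \<open>x\<close> is homologous to \<open>N x\<close> and so to \<open>N\<^sup>2 x\<close>, a combination of
  the representatives.  These are independent modulo boundaries because \<open>N\<close> fixes them, while
  \<open>N\<^sup>2 (bd y) = bd (N\<^sup>2 y) = 0\<close>.\<close>

lemma basis_mod_harm:
  assumes "w > 0"
  shows "basis_mod {x \<in> chains m w. bd x = 0} (bd ` chains (Suc m) w) (harm m w)"
  unfolding basis_mod_def
proof (intro conjI allI impI)
  show "harm m w \<subseteq> {x \<in> chains m w. bd x = 0}"
    using harm_properties(1,2) assms by blast
  show "{x \<in> chains m w. bd x = 0} \<subseteq> span (harm m w \<union> bd ` chains (Suc m) w)" (is "_ \<subseteq> span ?S")
  proof
    fix x assume "x \<in> {x \<in> chains m w. bd x = 0}"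
    then have x: "x \<in> chains m w" "bd x = 0" by auto
    have dx: "defect x = x - bd (htpy x)" by (simp add: defect_def x(2))
    then have "defect x \<in> chains m w"
      using x(1) by (simp add: subspace_diff[OF subspace_chains] bd_chains htpy_chains)
    then have y: "htpy x \<in> chains (Suc m) w" "htpy (defect x) \<in> chains (Suc m) w"
      using htpy_chains x(1) by auto
    have "defect (defect x) = defect x - bd (htpy (defect x))"
      by (subst defect_def[of "defect x"]) (simp add: bd_defect x(2))
    then have "x = bd (htpy x) + bd (htpy (defect x)) + defect (defect x)"
      using dx by simp
    moreover have "bd (htpy x) \<in> span ?S" "bd (htpy (defect x)) \<in> span ?S"
      using y by (auto intro: span_base)
    moreover have "defect (defect x) \<in> span ?S"
      using defect_defect_in_harm[OF x(1) assms] span_mono[of "harm m w" ?S] by blast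
    ultimately show "x \<in> span ?S" using span_add by metis
  qed
next
  fix T and c :: "(cell \<Rightarrow>\<^sub>0 real) \<Rightarrow> real"
  assume T: "finite T \<and> T \<subseteq> harm m w \<and> (\<Sum>b\<in>T. c b *\<^sub>R b) \<in> bd ` chains (Suc m) w"
  then obtain y where y: "y \<in> chains (Suc m) w" "(\<Sum>b\<in>T. c b *\<^sub>R b) = bd y" by auto
  have "defect (\<Sum>b\<in>T. c b *\<^sub>R b) = (\<Sum>b\<in>T. c b *\<^sub>R b)"
    using T harm_properties(3)[OF _ assms]
    by (auto simp: linear_sum[OF linear_defect] intro!: sum.cong)
  then have "(\<Sum>b\<in>T. c b *\<^sub>R b) = bd (defect (defect y))"
    using y(2) by (metis bd_defect)
  also have "\<dots> = 0"
    by (rule linear_eq_0_on_span[OF linear_bd _ defect_defect_in_harm[OF y(1) assms]])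
      (use harm_properties(2) assms in auto)
  finally show "\<forall>b\<in>T. c b = 0"
    using independent_harm[of m w] T unfolding independent_explicit_finite_subsets by blast
qed

text \<open>In degree \<open>w + 2\<close> both families contribute one class.\<close>

lemma card_harm:
  assumes "w > 0"
  shows "card (harm m w) =
    (if \<alpha> \<noteq> - 1 then 0
     else if m = w + 1 \<or> m = w + 3 then 1 else if m = w + 2 then 2 else 0)"
proof -
  obtain k where k: "w = Suc k" using assms by (cases w) auto
  have low_high: "harm_low True k \<noteq> harm_high False w"
  proof
    assume "harm_low True k = harm_high False w"
    then have "Poly_Mapping.lookup (harm_low True k) (Cell False True True False w 0 0) =
      Poly_Mapping.lookup (harm_high False w) (Cell False True True False w 0 0)" by simp
    then show False by (simp add: harm_low_def harm_high_def lookup_minus lookup_single when_def)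
  qed
  have harm: "harm m w = (if \<alpha> \<noteq> - 1 then {}
     else if m = w + 1 then {harm_low False k} else if m = w + 2 then {harm_low True k, harm_high False w}
     else if m = w + 3 then {harm_high True w} else {})"
    by (auto simp: harm_def k of_bool_def split: if_splits)
  show ?thesis using low_high by (simp add: harm)
qed

lemma dim_cycles_model:
  assumes "w > 0"
  shows "dim {x \<in> chains m w. bd x = 0} = dim (bd ` chains (Suc m) w) + card (harm m w)"
proof (rule card_basis_mod(2)[OF basis_mod_harm[OF assms]])
  show "subspace (bd ` chains (Suc m) w)"
    by (intro linear_subspace_image linear_bd subspace_chains)
  show "subspace {x \<in> chains m w. bd x = 0}"
    using subspace_chains[of m w] by (auto simp: subspace_def)
  show "bd ` chains (Suc m) w \<subseteq> {x \<in> chains m w. bd x = 0}"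
    using bd_chains bd_bd by auto
  show "{x \<in> chains m w. bd x = 0} \<subseteq> span (unit_vec ` cells m w)"
    by (auto simp: chains_def)
  show "finite (unit_vec ` cells m w)" by (simp add: finite_cells)
qed

lemma dim_chains_rank_nullity:
  "dim (chains m w) = dim {x \<in> chains m w. bd x = 0} + dim (bd ` chains m w)"
  by (rule rank_nullity[OF linear_bd subspace_chains, of _ _ "unit_vec ` cells m w"])
    (simp_all add: chains_def finite_cells)

end

section \<open>Presentations by generators and relations\<close>

text \<open>The common pattern of the exterior algebra and of the chain space: a quotient of a free vector space
  by a subspace \<open>R\<close> of relations, with a linear projection \<open>abs\<close> and a section \<open>rep\<close> that need not be
  linear.\<close>

locale free_quotient =
  fixes abs :: "('i \<Rightarrow>\<^sub>0 real) \<Rightarrow> 'q::real_vector"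
    and rep :: "'q \<Rightarrow> ('i \<Rightarrow>\<^sub>0 real)"
    and R :: "('i \<Rightarrow>\<^sub>0 real) set"
  assumes abs_rep: "abs (rep X) = X"
    and abs_eq_iff: "abs p = abs q \<longleftrightarrow> p - q \<in> R"
    and linear_abs: "linear abs"
begin

definition gen :: "'i \<Rightarrow> 'q" where "gen i = abs (unit_vec i)"

definition lift :: "('i \<Rightarrow> 'v::real_vector) \<Rightarrow> 'q \<Rightarrow> 'v" where
  "lift F X = lin_ext F (rep X)"

lemma span_gen: "span (range gen) = UNIV"
proof -
  have "X \<in> span (range gen)" for X
  proof -
    have "X = lin_ext gen (rep X)"
      using linear_eq_on_unit_vec[OF linear_abs linear_lin_ext, of gen "rep X"] abs_rep[of X]
      by (simp add: gen_def)
    also have "\<dots> \<in> span (range gen)"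
      unfolding lin_ext_def by (intro span_sum span_scale span_base) auto
    finally show ?thesis .
  qed
  then show ?thesis by blast
qed

lemma eq_on_gen:
  assumes "linear f" "linear g" "\<And>i. f (gen i) = g (gen i)"
  shows "f X = g X"
  by (rule linear_eq_on[OF assms(1,2), of X "range gen"]) (use span_gen assms(3) in auto)

lemma zero_iff: "abs p = 0 \<longleftrightarrow> p \<in> R"
  using abs_eq_iff[of p 0] by (simp add: linear_0[OF linear_abs])

context
  fixes F :: "'i \<Rightarrow> 'v::real_vector"
  assumes F: "\<And>r. r \<in> R \<Longrightarrow> lin_ext F r = 0"
begin

lemma lift_abs: "lift F (abs p) = lin_ext F p"
proof -
  have "rep (abs p) - p \<in> R" by (simp add: abs_eq_iff[symmetric] abs_rep)
  then show ?thesis using F[of "rep (abs p) - p"] by (simp add: lift_def)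
qed

lemma lift_gen: "lift F (gen i) = F i"
  by (simp add: gen_def lift_abs)

lemma linear_lift: "linear (lift F)"
proof (rule linearI)
  fix X Y :: 'q and c :: real
  have "lift F (abs (rep X + rep Y)) = lift F X + lift F Y"
    unfolding lift_abs by (simp add: lift_def)
  then show "lift F (X + Y) = lift F X + lift F Y"
    by (simp add: linear_add[OF linear_abs] abs_rep)
  have "lift F (abs (c *\<^sub>R rep X)) = c *\<^sub>R lift F X"
    unfolding lift_abs by (simp add: lift_def)
  then show "lift F (c *\<^sub>R X) = c *\<^sub>R lift F X"
    by (simp add: linear_scale[OF linear_abs] abs_rep)
qed

end

end

lemma free_quotient_ext: "free_quotient abs_ext rep_ext ext_rel"
  unfolding free_quotient_def
  by (auto simp: Quotient3_abs_rep[OF Quotient3_ext] ext.abs_eq_iff plus_ext.abs_eq scaleR_ext.abs_eq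
      intro!: linearI)

lemma free_quotient_chain: "free_quotient abs_chain rep_chain chain_rel"
  unfolding free_quotient_def
  by (auto simp: Quotient3_abs_rep[OF Quotient3_chain] chain.abs_eq_iff plus_chain.abs_eq scaleR_chain.abs_eq
      intro!: linearI)

interpretation extq: free_quotient abs_ext rep_ext ext_rel by (rule free_quotient_ext)

interpretation chainq: free_quotient abs_chain rep_chain chain_rel by (rule free_quotient_chain)

lemma gen_wedge: "extq.gen = wedge"
  by (rule HOL.ext) (simp add: extq.gen_def wedge_def word_def)

lemma gen_tri: "chainq.gen = tri"
  by (rule HOL.ext) (simp add: chainq.gen_def tri_def word_def)

lemma lin_ext_word [simp]: "lin_ext F (word xs) = F xs"
  by (simp add: word_def)

subsection \<open>The exterior algebra\<close>

definition alternating :: "('a::real_vector list \<Rightarrow> 'v::real_vector) \<Rightarrow> bool" where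
  "alternating F \<longleftrightarrow>
     (\<forall>u v x y. F (u @ (x + y) # v) = F (u @ x # v) + F (u @ y # v)) \<and>
     (\<forall>u v c x. F (u @ (c *\<^sub>R x) # v) = c *\<^sub>R F (u @ x # v)) \<and>
     (\<forall>u v x. F (u @ x # x # v) = 0)"

lemma alternating_ext_rel:
  assumes "alternating F" "r \<in> ext_rel"
  shows "lin_ext F r = 0"
  by (rule linear_eq_0_on_span[OF linear_lin_ext _ assms(2)[unfolded ext_rel_def]])
    (use assms(1) in \<open>auto simp: tensor_rel_def alternating_def\<close>)

lemma alternating_wedge: "alternating wedge"
proof -
  have rel: "r \<in> ext_rel" if "r \<in> tensor_rel UNIV \<union> {word (u @ x # x # v) | u x v. True}"
    for r :: "'a list \<Rightarrow>\<^sub>0 real"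
    unfolding ext_rel_def using that by (rule span_base)
  have "wedge (u @ (x + y) # v) = wedge (u @ x # v) + wedge (u @ y # v)" for u v and x y :: 'a
  proof -
    have "abs_ext (word (u @ (x + y) # v) - word (u @ x # v) - word (u @ y # v)) = 0"
      unfolding extq.zero_iff by (rule rel, unfold tensor_rel_def) blast
    then show ?thesis by (simp add: wedge_def linear_diff[OF extq.linear_abs] linear_add[OF extq.linear_abs] algebra_simps)
  qed
  moreover have "wedge (u @ (c *\<^sub>R x) # v) = c *\<^sub>R wedge (u @ x # v)" for u v c and x :: 'a
  proof -
    have "abs_ext (word (u @ (c *\<^sub>R x) # v) - c *\<^sub>R word (u @ x # v)) = 0"
      unfolding extq.zero_iff by (rule rel, unfold tensor_rel_def) blast
    then show ?thesis by (simp add: wedge_def linear_diff[OF extq.linear_abs] linear_scale[OF extq.linear_abs])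
  qed
  moreover have "wedge (u @ x # x # v) = 0" for u v and x :: 'a
    unfolding wedge_def extq.zero_iff by (rule rel) auto
  ultimately show ?thesis unfolding alternating_def by blast
qed

lemma wedge_add: "wedge (u @ (x + y) # v) = wedge (u @ x # v) + wedge (u @ y # v)"
  and wedge_scale: "wedge (u @ (c *\<^sub>R x) # v) = c *\<^sub>R wedge (u @ x # v)"
  and wedge_repeat: "wedge (u @ x # x # v) = 0"
  using alternating_wedge unfolding alternating_def by blast+

text \<open>Polarization of \<open>wedge_repeat\<close> at \<open>x + y\<close>.\<close>

lemma wedge_swap: "wedge (u @ x # y # v) = - wedge (u @ y # x # v)"
proof -
  have "0 = wedge (u @ (x + y) # (x + y) # v)" by (simp add: wedge_repeat)
  also have "\<dots> = wedge (u @ x # (x + y) # v) + wedge (u @ y # (x + y) # v)" by (rule wedge_add)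
  also have "\<dots> = wedge ((u @ [x]) @ (x + y) # v) + wedge ((u @ [y]) @ (x + y) # v)" by simp
  also have "\<dots> = wedge (u @ x # y # v) + wedge (u @ y # x # v)"
    unfolding wedge_add by (simp add: wedge_repeat)
  finally show ?thesis by (simp add: eq_neg_iff_add_eq_0)
qed

lemma lift_wedge: "alternating F \<Longrightarrow> extq.lift F (wedge as) = F as"
  using extq.lift_gen[OF alternating_ext_rel] by (simp add: gen_wedge)

lemma linear_ext_lift: "alternating F \<Longrightarrow> linear (extq.lift F)"
  by (rule extq.linear_lift[OF alternating_ext_rel])

lemma eq_on_wedge:
  assumes "linear f" "linear g" "\<And>as. f (wedge as) = g (wedge as)"
  shows "f X = g X"
  using extq.eq_on_gen[OF assms(1,2)] assms(3) by (simp add: gen_wedge)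

lemma alternating_Cons:
  assumes "alternating F" shows "alternating (\<lambda>as. F (x # as))"
  unfolding alternating_def
proof (intro conjI allI)
  fix u v c and y z
  show "F (x # u @ (y + z) # v) = F (x # u @ y # v) + F (x # u @ z # v)"
    "F (x # u @ (c *\<^sub>R y) # v) = c *\<^sub>R F (x # u @ y # v)" "F (x # u @ y # y # v) = 0"
    using assms unfolding alternating_def by (metis append_Cons)+
qed

subsection \<open>The chain space\<close>

text \<open>The functions on words that factor through the chain space.\<close>

definition chain_form :: "('a::real_vector ext list \<Rightarrow> 'v::real_vector) \<Rightarrow> bool" where
  "chain_form F \<longleftrightarrow>
     (\<forall>Ys. \<not> set Ys \<subseteq> gbar \<longrightarrow> F Ys = 0) \<and>
     (\<forall>u v X Y. X \<in> gbar \<longrightarrow> Y \<in> gbar \<longrightarrow> F (u @ (X + Y) # v) = F (u @ X # v) + F (u @ Y # v)) \<and>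
     (\<forall>u v c X. X \<in> gbar \<longrightarrow> F (u @ (c *\<^sub>R X) # v) = c *\<^sub>R F (u @ X # v)) \<and>
     (\<forall>u v X Y x y. X \<in> grd x \<longrightarrow> Y \<in> grd y \<longrightarrow>
        F (u @ X # Y # v) + (- 1) ^ (x * y) *\<^sub>R F (u @ Y # X # v) = 0)"

lemma chain_form_chain_rel:
  assumes "chain_form F" "r \<in> chain_rel"
  shows "lin_ext F r = 0"
  by (rule linear_eq_0_on_span[OF linear_lin_ext _ assms(2)[unfolded chain_rel_def]])
    (use assms(1) in \<open>auto simp: tensor_rel_def chain_form_def\<close>)

lemma chain_form_tri: "chain_form tri"
proof -
  have rel: "r \<in> chain_rel" if "r \<in> tensor_rel gbar \<union>
     {word (u @ X # Y # v) + (-1) ^ (x * y) *\<^sub>R word (u @ Y # X # v) | u v X Y x y.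
        X \<in> grd x \<and> Y \<in> grd y}" for r :: "'a ext list \<Rightarrow>\<^sub>0 real"
    unfolding chain_rel_def using that by (rule span_base)
  have "tri Ys = 0" if "\<not> set Ys \<subseteq> gbar" for Ys :: "'a ext list"
    unfolding tri_def chainq.zero_iff by (rule rel) (use that in \<open>auto simp: tensor_rel_def\<close>)
  moreover have "tri (u @ (x + y) # v) = tri (u @ x # v) + tri (u @ y # v)"
    if "x \<in> gbar" "y \<in> gbar" for u v and x y :: "'a ext"
  proof -
    have "abs_chain (word (u @ (x + y) # v) - word (u @ x # v) - word (u @ y # v)) = 0"
      unfolding chainq.zero_iff by (rule rel) (use that in \<open>auto simp: tensor_rel_def\<close>)
    then show ?thesis by (simp add: tri_def linear_diff[OF chainq.linear_abs] linear_add[OF chainq.linear_abs] algebra_simps)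
  qed
  moreover have "tri (u @ (c *\<^sub>R x) # v) = c *\<^sub>R tri (u @ x # v)"
    if "x \<in> gbar" for u v c and x :: "'a ext"
  proof -
    have "abs_chain (word (u @ (c *\<^sub>R x) # v) - c *\<^sub>R word (u @ x # v)) = 0"
      unfolding chainq.zero_iff by (rule rel) (use that in \<open>auto simp: tensor_rel_def\<close>)
    then show ?thesis by (simp add: tri_def linear_diff[OF chainq.linear_abs] linear_scale[OF chainq.linear_abs])
  qed
  moreover have "tri (u @ X # Y # v) + (- 1) ^ (x * y) *\<^sub>R tri (u @ Y # X # v) = 0"
    if "X \<in> grd x" "Y \<in> grd y" for u v x y and X Y :: "'a ext"
  proof -
    have "abs_chain (word (u @ X # Y # v) + (- 1) ^ (x * y) *\<^sub>R word (u @ Y # X # v)) = 0"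
      unfolding chainq.zero_iff by (rule rel) (use that in auto)
    then show ?thesis by (simp add: tri_def linear_add[OF chainq.linear_abs] linear_scale[OF chainq.linear_abs])
  qed
  ultimately show ?thesis unfolding chain_form_def by blast
qed

lemma lift_tri: "chain_form F \<Longrightarrow> chainq.lift F (tri as) = F as"
  using chainq.lift_gen[OF chain_form_chain_rel] by (simp add: gen_tri)

lemma linear_chain_lift: "chain_form F \<Longrightarrow> linear (chainq.lift F)"
  by (rule chainq.linear_lift[OF chain_form_chain_rel])

lemma eq_on_tri:
  assumes "linear f" "linear g" "\<And>Ys. f (tri Ys) = g (tri Ys)"
  shows "f c = g c"
  using chainq.eq_on_gen[OF assms(1,2)] assms(3) by (simp add: gen_tri)

lemma chain_form_Cons:
  assumes "chain_form F" shows "chain_form (\<lambda>Ys. F (Z # Ys))"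
  unfolding chain_form_def
proof (intro conjI allI impI)
  fix u v Ys X Y and c :: real and x y :: nat
  show "F (Z # Ys) = 0" if "\<not> set Ys \<subseteq> gbar"
    using assms that unfolding chain_form_def by simp
  show "F (Z # u @ (X + Y) # v) = F (Z # u @ X # v) + F (Z # u @ Y # v)" if "X \<in> gbar" "Y \<in> gbar"
    using assms that unfolding chain_form_def by (metis append_Cons)
  show "F (Z # u @ (c *\<^sub>R X) # v) = c *\<^sub>R F (Z # u @ X # v)" if "X \<in> gbar"
    using assms that unfolding chain_form_def by (metis append_Cons)
  show "F (Z # u @ X # Y # v) + (- 1) ^ (x * y) *\<^sub>R F (Z # u @ Y # X # v) = 0"
    if "X \<in> grd x" "Y \<in> grd y"
    using assms that unfolding chain_form_def by (metis append_Cons)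
qed

definition prep :: "'a::real_vector ext \<Rightarrow> 'a chain \<Rightarrow> 'a chain" where
  "prep Y = chainq.lift (\<lambda>Ys. tri (Y # Ys))"

lemma prep_tri [simp]: "prep Y (tri Ys) = tri (Y # Ys)"
  unfolding prep_def by (rule lift_tri[OF chain_form_Cons[OF chain_form_tri]])

lemma linear_prep: "linear (prep Y)"
  unfolding prep_def by (rule linear_chain_lift[OF chain_form_Cons[OF chain_form_tri]])

lemmas prep_simps [simp] =
  linear_add[OF linear_prep] linear_diff[OF linear_prep] linear_scale[OF linear_prep]
  linear_neg[OF linear_prep] linear_0[OF linear_prep]

lemma tri_outside: "\<not> set Ys \<subseteq> gbar \<Longrightarrow> tri Ys = 0"
  using chain_form_tri unfolding chain_form_def by blast

lemma tri_Cons_add: "X \<in> gbar \<Longrightarrow> Y \<in> gbar \<Longrightarrow> tri ((X + Y) # Ys) = tri (X # Ys) + tri (Y # Ys)"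
proof -
  have "X \<in> gbar \<longrightarrow> Y \<in> gbar \<longrightarrow> tri ([] @ (X + Y) # Ys) = tri ([] @ X # Ys) + tri ([] @ Y # Ys)"
    using chain_form_tri unfolding chain_form_def by blast
  then show "X \<in> gbar \<Longrightarrow> Y \<in> gbar \<Longrightarrow> tri ((X + Y) # Ys) = tri (X # Ys) + tri (Y # Ys)" by simp
qed

lemma tri_Cons_scale: "X \<in> gbar \<Longrightarrow> tri ((c *\<^sub>R X) # Ys) = c *\<^sub>R tri (X # Ys)"
proof -
  have "X \<in> gbar \<longrightarrow> tri ([] @ (c *\<^sub>R X) # Ys) = c *\<^sub>R tri ([] @ X # Ys)"
    using chain_form_tri unfolding chain_form_def by blast
  then show "X \<in> gbar \<Longrightarrow> tri ((c *\<^sub>R X) # Ys) = c *\<^sub>R tri (X # Ys)" by simp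
qed

lemma tri_swap:
  assumes "X \<in> grd x" "Y \<in> grd y"
  shows "tri (X # Y # Ys) = - ((- 1) ^ (x * y)) *\<^sub>R tri (Y # X # Ys)"
proof -
  have "X \<in> grd x \<longrightarrow> Y \<in> grd y \<longrightarrow>
    tri ([] @ X # Y # Ys) + (- 1) ^ (x * y) *\<^sub>R tri ([] @ Y # X # Ys) = 0"
    using chain_form_tri unfolding chain_form_def by blast
  then show ?thesis using assms by (simp add: add_eq_0_iff2)
qed

lemma prep_swap:
  assumes "X \<in> grd x" "Y \<in> grd y"
  shows "prep X (prep Y c) = - ((- 1) ^ (x * y)) *\<^sub>R prep Y (prep X c)"
proof (rule eq_on_tri[where c = c])
  show "linear (\<lambda>c. prep X (prep Y c))" "linear (\<lambda>c. - ((- 1) ^ (x * y)) *\<^sub>R prep Y (prep X c))"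
    by (rule linearI; simp add: algebra_simps)+
  show "prep X (prep Y (tri Ys)) = - ((- 1) ^ (x * y)) *\<^sub>R prep Y (prep X (tri Ys))" for Ys
    using tri_swap[OF assms] by simp
qed

lemma subspace_gbar: "subspace gbar"
  by (simp add: gbar_def)

lemma grd_gbar: "grd i \<subseteq> gbar"
  unfolding gbar_def using span_superset[of "\<Union>i. grd i"] by blast

section \<open>The Lie algebra and its exterior algebra\<close>

instance letter :: finite
proof
  have "(UNIV :: letter set) = {Z3, Z1, Z2, V, U1, U2, U3}"
    using letter.exhaust by auto
  then show "finite (UNIV :: letter set)" by (metis finite.emptyI finite.insertI)
qed

lemma UNIV_letter: "(UNIV :: letter set) = {Z3, Z1, Z2, V, U1, U2, U3}"
  using letter.exhaust by auto

lemma sum_letter: "(\<Sum>l\<in>UNIV. f l) = f Z3 + f Z1 + f Z2 + f V + f U1 + f U2 + f U3"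
  for f :: "letter \<Rightarrow> 'v::comm_monoid_add"
  by (simp add: UNIV_letter add_ac)

lemma short_list_cases:
  "length xs \<le> 2 \<Longrightarrow> xs = [] \<or> (\<exists>x. xs = [x]) \<or> (\<exists>x y. xs = [x, y])"
  by (cases xs; cases "tl xs"; cases "tl (tl xs)") auto

locale lie3 = model \<alpha> for \<alpha> :: real +
  fixes br :: "'a::real_vector \<Rightarrow> 'a \<Rightarrow> 'a" and z1 z2 z3 :: 'a
  assumes lie: "lie_bracket br"
    and dist: "distinct [z1, z2, z3]"
    and indep: "independent {z1, z2, z3}"
    and spans: "span {z1, z2, z3} = (UNIV :: 'a set)"
    and br12: "br z1 z2 = 0" and br13: "br z1 z3 = z1" and br23: "br z2 z3 = \<alpha> *\<^sub>R z2"
begin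

subsection \<open>Coordinates on the Lie algebra\<close>

definition c1 :: "'a \<Rightarrow> real" where "c1 x = representation {z1, z2, z3} x z1"
definition c2 :: "'a \<Rightarrow> real" where "c2 x = representation {z1, z2, z3} x z2"
definition c3 :: "'a \<Rightarrow> real" where "c3 x = representation {z1, z2, z3} x z3"

lemma decompose: "x = c1 x *\<^sub>R z1 + c2 x *\<^sub>R z2 + c3 x *\<^sub>R z3"
proof -
  have "(\<Sum>b\<in>{z1, z2, z3}. representation {z1, z2, z3} x b *\<^sub>R b) = x"
    by (rule sum_representation_eq[OF indep]) (use spans in auto)
  then show ?thesis using dist by (simp add: c1_def c2_def c3_def add_ac)
qed

lemma c_add [simp]: "c1 (x + y) = c1 x + c1 y" "c2 (x + y) = c2 x + c2 y" "c3 (x + y) = c3 x + c3 y"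
  unfolding c1_def c2_def c3_def by (subst representation_add[OF indep]; simp add: spans)+

lemma c_scale [simp]: "c1 (k *\<^sub>R x) = k * c1 x" "c2 (k *\<^sub>R x) = k * c2 x" "c3 (k *\<^sub>R x) = k * c3 x"
  unfolding c1_def c2_def c3_def by (subst representation_scale[OF indep]; simp add: spans)+

lemma c_basis [simp]:
  "c1 z1 = 1" "c1 z2 = 0" "c1 z3 = 0" "c2 z1 = 0" "c2 z2 = 1" "c2 z3 = 0" "c3 z1 = 0" "c3 z2 = 0" "c3 z3 = 1"
  unfolding c1_def c2_def c3_def using dist by (subst representation_basis[OF indep]; auto)+

lemma c_zero [simp]: "c1 0 = 0" "c2 0 = 0" "c3 0 = 0"
  using c_scale[of 0 0] by simp_all

lemma br_bilinear:
  "br (x + y) z = br x z + br y z" "br x (y + z) = br x y + br x z"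
  "br (k *\<^sub>R x) y = k *\<^sub>R br x y" "br x (k *\<^sub>R y) = k *\<^sub>R br x y"
  using lie unfolding lie_bracket_def
  by (auto simp: bilinear_ladd bilinear_radd bilinear_lmul bilinear_rmul)

lemma br_same: "br x x = 0"
  using lie unfolding lie_bracket_def by blast

lemma br_swap: "br x y = - br y x"
proof -
  have "0 = br (x + y) (x + y)" by (simp add: br_same)
  also have "\<dots> = br x y + br y x"
    by (simp only: br_bilinear(1,2)) (simp add: br_same)
  finally show ?thesis by (simp add: eq_neg_iff_add_eq_0)
qed

lemma br_coordinates: "br x y = (c1 x * c3 y - c3 x * c1 y) *\<^sub>R z1 + (\<alpha> * (c2 x * c3 y - c3 x * c2 y)) *\<^sub>R z2"
proof -
  have b: "br z2 z1 = 0" "br z3 z1 = - z1" "br z3 z2 = - (\<alpha> *\<^sub>R z2)"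
    using br_swap[of z2 z1] br_swap[of z3 z1] br_swap[of z3 z2] by (simp_all add: br12 br13 br23)
  have "br x y = br (c1 x *\<^sub>R z1 + c2 x *\<^sub>R z2 + c3 x *\<^sub>R z3) (c1 y *\<^sub>R z1 + c2 y *\<^sub>R z2 + c3 y *\<^sub>R z3)"
    using decompose[of x] decompose[of y] by simp
  also have "\<dots> = (c1 x * c3 y - c3 x * c1 y) *\<^sub>R z1 + (\<alpha> * (c2 x * c3 y - c3 x * c2 y)) *\<^sub>R z2"
    by (simp add: br_bilinear br_same b br12 br13 br23 algebra_simps)
  finally show ?thesis .
qed

lemma c_br [simp]: "c1 (br x y) = c1 x * c3 y - c3 x * c1 y"
  "c2 (br x y) = \<alpha> * (c2 x * c3 y - c3 x * c2 y)" "c3 (br x y) = 0"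
  by (subst br_coordinates; simp)+

subsection \<open>Coordinates on the exterior algebra\<close>

text \<open>The minors of the matrix of coordinates, with the columns named by the letter.  They are the
  coordinates of a product of vectors in the exterior algebra.\<close>

fun minor :: "letter \<Rightarrow> 'a list \<Rightarrow> real" where
  "minor Z1 [x] = c1 x"
| "minor Z2 [x] = c2 x"
| "minor Z3 [x] = c3 x"
| "minor U1 [x, y] = c1 x * c2 y - c2 x * c1 y"
| "minor U2 [x, y] = c1 x * c3 y - c3 x * c1 y"
| "minor U3 [x, y] = c2 x * c3 y - c3 x * c2 y"
| "minor V [x, y, z] = c1 x * (c2 y * c3 z - c3 y * c2 z) - c2 x * (c1 y * c3 z - c3 y * c1 z)
     + c3 x * (c1 y * c2 z - c2 y * c1 z)"
| "minor _ _ = 0"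

lemma minor_length: "length as \<noteq> Suc (grade l) \<Longrightarrow> minor l as = 0"
  by (cases "(l, as)" rule: minor.cases) auto

lemma alternating_minor: "alternating (minor l)"
proof -
  have grade: "grade l \<le> 2" by (cases l) auto
  have multilinear: "minor l (u @ (x + y) # v) = minor l (u @ x # v) + minor l (u @ y # v)
      \<and> minor l (u @ (k *\<^sub>R x) # v) = k *\<^sub>R minor l (u @ x # v)" for u v x y k
  proof (cases "length u + length v = grade l")
    case True
    with grade have "length u \<le> 2" "length v \<le> 2" by auto
    from short_list_cases[OF this(1)] short_list_cases[OF this(2)] True show ?thesis
      by (elim disjE exE; cases l; simp add: algebra_simps)
  qed (simp add: minor_length)
  moreover have "minor l (u @ x # x # v) = 0" for u v x
  proof (cases "length u + length v + 1 = grade l")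
    case True
    with grade have "length u \<le> 2" "length v \<le> 2" by auto
    from short_list_cases[OF this(1)] short_list_cases[OF this(2)] True show ?thesis
      by (elim disjE exE; cases l; simp add: algebra_simps)
  qed (simp add: minor_length)
  ultimately show ?thesis unfolding alternating_def by blast
qed

text \<open>The coordinate of the empty product, which spans a complement of \<open>gbar\<close>.\<close>

definition unit_coeff :: "'a list \<Rightarrow> real" where
  "unit_coeff as = (if as = [] then 1 else 0)"

lemma alternating_unit_coeff: "alternating unit_coeff"
  by (simp add: alternating_def unit_coeff_def)

definition coord :: "letter \<Rightarrow> 'a ext \<Rightarrow> real" where "coord l = extq.lift (minor l)"
definition scal :: "'a ext \<Rightarrow> real" where "scal = extq.lift unit_coeff"

lemma coord_wedge: "coord l (wedge as) = minor l as"
  unfolding coord_def by (rule lift_wedge[OF alternating_minor])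
lemma scal_wedge: "scal (wedge as) = unit_coeff as"
  unfolding scal_def by (rule lift_wedge[OF alternating_unit_coeff])
lemma linear_coord: "linear (coord l)"
  unfolding coord_def by (rule linear_ext_lift[OF alternating_minor])
lemma linear_scal: "linear scal"
  unfolding scal_def by (rule linear_ext_lift[OF alternating_unit_coeff])

lemmas coord_simps [simp] =
  linear_add[OF linear_coord] linear_diff[OF linear_coord] linear_scale[OF linear_coord]
  linear_neg[OF linear_coord] linear_0[OF linear_coord] linear_sum[OF linear_coord]
  linear_add[OF linear_scal] linear_diff[OF linear_scal] linear_scale[OF linear_scal]
  linear_neg[OF linear_scal] linear_0[OF linear_scal] linear_sum[OF linear_scal]

fun elt :: "letter \<Rightarrow> 'a ext" where
  "elt Z1 = wedge [z1]" | "elt Z2 = wedge [z2]" | "elt Z3 = wedge [z3]"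
| "elt U1 = wedge [z1, z2]" | "elt U2 = wedge [z1, z3]" | "elt U3 = wedge [z2, z3]"
| "elt V = wedge [z1, z2, z3]"

lemma coord_elt [simp]: "coord l (elt l') = of_bool (l = l')"
  by (cases l; cases l') (simp_all add: coord_wedge)

lemma scal_elt [simp]: "scal (elt l) = 0"
  by (cases l) (simp_all add: scal_wedge unit_coeff_def)

text \<open>Rewrite rules that sort a product of at most four basis vectors.\<close>

lemma wedge_rules:
  "wedge (x # x # v) = 0" "wedge (y # x # x # v) = 0" "wedge (y # z # x # x # v) = 0"
  "wedge (z2 # z1 # v) = - wedge (z1 # z2 # v)" "wedge (z3 # z1 # v) = - wedge (z1 # z3 # v)"
  "wedge (z3 # z2 # v) = - wedge (z2 # z3 # v)"
  "wedge (y # z2 # z1 # v) = - wedge (y # z1 # z2 # v)" "wedge (y # z3 # z1 # v) = - wedge (y # z1 # z3 # v)"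
  "wedge (y # z3 # z2 # v) = - wedge (y # z2 # z3 # v)"
  "wedge (y # z # z3 # z2 # v) = - wedge (y # z # z2 # z3 # v)"
  by (rule wedge_repeat[of "[]", unfolded append_Nil],
      rule wedge_repeat[of "[y]", unfolded append_Cons append_Nil],
      rule wedge_repeat[of "[y, z]", unfolded append_Cons append_Nil],
      (rule wedge_swap[of "[]", unfolded append_Nil])+,
      (rule wedge_swap[of "[y]", unfolded append_Cons append_Nil])+,
      rule wedge_swap[of "[y, z]", unfolded append_Cons append_Nil])

text \<open>Left multiplication by a vector preserves the span of the eight sorted products.\<close>

lemma span_elt: "span (insert (wedge []) (range elt)) = UNIV"
proof -
  let ?S = "span (insert (wedge []) (range elt))"
  have elt_in: "elt l \<in> ?S" for l by (auto intro: span_base)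
  note gens = elt_in[of Z1, simplified] elt_in[of Z2, simplified] elt_in[of Z3, simplified]
    elt_in[of U1, simplified] elt_in[of U2, simplified] elt_in[of U3, simplified] elt_in[of V, simplified]
  have "wedge as \<in> ?S" for as
  proof (induction as)
    case Nil
    show ?case by (auto intro: span_base)
  next
    case (Cons x as)
    note alt = alternating_Cons[OF alternating_wedge]
    have lin: "linear (extq.lift (\<lambda>as. wedge (x # as)))" by (rule linear_ext_lift[OF alt])
    have x: "wedge (x # bs) = c1 x *\<^sub>R wedge (z1 # bs) + c2 x *\<^sub>R wedge (z2 # bs) + c3 x *\<^sub>R wedge (z3 # bs)" for bs
      by (subst decompose[of x])
        (simp add: wedge_add[of "[]", simplified] wedge_scale[of "[]", simplified])
    have "extq.lift (\<lambda>as. wedge (x # as)) (wedge as) \<in> ?S"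
    proof (rule linear_image_span_subset[OF lin _ Cons.IH])
      fix y assume "y \<in> insert (wedge []) (range elt)"
      then consider "y = wedge []" | l where "y = elt l" by blast
      then show "extq.lift (\<lambda>as. wedge (x # as)) y \<in> ?S"
      proof cases
        case 1
        show ?thesis unfolding 1 lift_wedge[OF alt] unfolding x
          by (intro span_add span_scale gens)
      next
        case 2
        show ?thesis unfolding 2
          by (cases l; simp only: elt.simps lift_wedge[OF alt]; simp only: x; intro span_add span_scale)
            (simp_all add: wedge_rules gens span_neg span_zero)
      qed
    qed
    then show ?case by (simp add: lift_wedge[OF alt])
  qed
  then have "range (extq.gen :: 'a list \<Rightarrow> 'a ext) \<subseteq> ?S" by (auto simp: gen_wedge)
  then have "span (range (extq.gen :: 'a list \<Rightarrow> 'a ext)) \<subseteq> ?S" by (rule span_minimal) simp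
  then show ?thesis by (simp add: extq.span_gen top.extremum_unique)
qed

lemma ext_expand: "X = scal X *\<^sub>R wedge [] + (\<Sum>l\<in>UNIV. coord l X *\<^sub>R elt l)"
proof (rule linear_eq_on[where x = X and B = "insert (wedge []) (range elt)"])
  show "linear (\<lambda>X. X :: 'a ext)" by (rule linear_id[unfolded id_def])
  show "linear (\<lambda>X. scal X *\<^sub>R wedge [] + (\<Sum>l\<in>UNIV. coord l X *\<^sub>R elt l))"
    by (rule linearI) (simp_all add: sum.distrib scaleR_sum_right algebra_simps)
  show "X \<in> span (insert (wedge []) (range elt))" by (simp add: span_elt)
  fix b assume "b \<in> insert (wedge []) (range elt)"
  then consider "b = wedge []" | l where "b = elt l" by blast
  then show "b = scal b *\<^sub>R wedge [] + (\<Sum>l\<in>UNIV. coord l b *\<^sub>R elt l)"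
  proof cases
    case 1
    show ?thesis unfolding 1 by (simp add: scal_wedge coord_wedge unit_coeff_def minor_length)
  next
    case 2
    show ?thesis unfolding 2 scal_elt coord_elt
      by (cases l) (simp_all add: sum_letter del: elt.simps)
  qed
qed

lemma ext_eqI: "scal X = scal Y \<Longrightarrow> (\<And>l. coord l X = coord l Y) \<Longrightarrow> X = Y"
  using ext_expand[of X] ext_expand[of Y] by simp

lemma grd_coord: "X \<in> grd x \<Longrightarrow> grade l \<noteq> x \<Longrightarrow> coord l X = 0"
  unfolding grd_def
  by (rule linear_eq_0_on_span[OF linear_coord]) (auto simp: coord_wedge minor_length)

lemma gbar_scal:
  assumes "X \<in> gbar" shows "scal X = 0"
proof (rule linear_eq_0_on_span[OF linear_scal _ assms[unfolded gbar_def]])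
  fix Y :: "'a ext" assume "Y \<in> (\<Union>i. grd i)"
  then obtain i where "Y \<in> grd i" by blast
  then show "scal Y = 0"
    unfolding grd_def
    by (rule linear_eq_0_on_span[OF linear_scal, rotated]) (auto simp: scal_wedge unit_coeff_def)
qed

lemma elt_grd: "elt l \<in> grd (grade l)"
  unfolding grd_def by (cases l) (auto intro!: span_base)

lemma elt_gbar: "elt l \<in> gbar"
  using elt_grd grd_gbar by blast

lemma gbar_expand: "X \<in> gbar \<Longrightarrow> X = (\<Sum>l\<in>UNIV. coord l X *\<^sub>R elt l)"
  using ext_expand[of X] gbar_scal[of X] by simp

subsection \<open>The Schouten bracket\<close>

text \<open>The bracket through its structure constants.\<close>

definition sch :: "'a ext \<Rightarrow> 'a ext \<Rightarrow> 'a ext" where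
  "sch X Y = (\<Sum>l\<in>UNIV. \<Sum>l'\<in>UNIV. (coord l X * coord l' Y * br_coeff l l') *\<^sub>R elt (br_letter l l'))"

lemma coord_sch:
  "coord Z3 (sch X Y) = 0"
  "coord Z1 (sch X Y) = coord Z1 X * coord Z3 Y - coord Z3 X * coord Z1 Y"
  "coord Z2 (sch X Y) = \<alpha> * (coord Z2 X * coord Z3 Y - coord Z3 X * coord Z2 Y)"
  "coord U1 (sch X Y) = coord U3 X * coord Z1 Y - coord Z1 X * coord U3 Y
     + \<alpha> * (coord Z2 X * coord U2 Y - coord U2 X * coord Z2 Y)
     + (1 + \<alpha>) * (coord U1 X * coord Z3 Y - coord Z3 X * coord U1 Y)"
  "coord U2 (sch X Y) = coord U2 X * coord Z3 Y - coord Z3 X * coord U2 Y"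
  "coord U3 (sch X Y) = \<alpha> * (coord U3 X * coord Z3 Y - coord Z3 X * coord U3 Y)"
  "coord V (sch X Y) = (1 + \<alpha>) * (coord V X * coord Z3 Y - coord Z3 X * coord V Y)
     + (1 - \<alpha>) * (coord U2 X * coord U3 Y + coord U3 X * coord U2 Y)"
  unfolding sch_def sum_letter
  by (simp_all add: algebra_simps del: elt.simps)

text \<open>Both sides are compared in coordinates.  The right-hand side is a combination of products of
  \<open>length as + length bs - 1\<close> vectors, so only few pairs of lengths have a nonzero coordinate; for these
  the claim is a polynomial identity between minors.\<close>

lemma sch_wedge:
  "sch (wedge as) (wedge bs) = (\<Sum>i<length as. \<Sum>j<length bs.
     (-1) ^ (i + j) *\<^sub>R wedge (br (as ! i) (bs ! j) # omit i as @ omit j bs))" (is "?L = ?R")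
proof (rule ext_eqI)
  show "scal ?L = scal ?R"
    by (simp add: sch_def scal_wedge unit_coeff_def del: elt.simps)
  fix k
  have L: "coord k ?L = (\<Sum>l\<in>UNIV. \<Sum>l'\<in>UNIV. minor l as * minor l' bs * br_coeff l l' * of_bool (k = br_letter l l'))"
    by (simp add: sch_def coord_wedge del: elt.simps)
  have R: "coord k ?R = (\<Sum>i<length as. \<Sum>j<length bs.
     (-1) ^ (i + j) * minor k (br (as ! i) (bs ! j) # omit i as @ omit j bs))"
    by (simp add: coord_wedge)
  show "coord k ?L = coord k ?R"
  proof (cases "as \<noteq> [] \<and> bs \<noteq> [] \<and> length as + length bs = grade k + 2")
    case False
    have len: "length (br x y # omit i as @ omit j bs) + 1 = length as + length bs"
      if "i < length as" "j < length bs" for i j x y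
      using that by (auto simp: omit_def)
    have "minor k (br (as ! i) (bs ! j) # omit i as @ omit j bs) = 0"
      if "i < length as" "j < length bs" for i j
      by (rule minor_length) (use False len[OF that] that in auto)
    then have "coord k ?R = 0" unfolding R by (auto intro!: sum.neutral)
    moreover have "minor l as * minor l' bs * br_coeff l l' * of_bool (k = br_letter l l') = 0" for l l'
    proof (rule ccontr)
      assume nz: "minor l as * minor l' bs * br_coeff l l' * of_bool (k = br_letter l l') \<noteq> 0"
      then have "length as = Suc (grade l)" "length bs = Suc (grade l')"
        using minor_length[of as l] minor_length[of bs l'] by auto
      moreover have "br_coeff l l' \<noteq> 0" "k = br_letter l l'" using nz by auto
      then have "grade k = grade l + grade l'" by (cases l; cases l') auto
      ultimately show False using False by auto
    qed
    then have "coord k ?L = 0" unfolding L by (intro sum.neutral ballI)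
    ultimately show ?thesis by simp
  next
    case True
    then obtain x xs y ys where as: "as = x # xs" and bs: "bs = y # ys"
      by (cases as; cases bs) auto
    have "grade k \<le> 2" by (cases k) auto
    then have "length xs \<le> 2" "length ys \<le> 2" using True by (auto simp: as bs)
    from short_list_cases[OF this(1)] short_list_cases[OF this(2)] True show ?thesis
      unfolding R as bs
      by (elim disjE exE; cases k; simp add: coord_sch coord_wedge omit_def algebra_simps)
  qed
qed

declare elt.simps [simp del]

lemma bilinear_sch: "bilinear sch"
  unfolding bilinear_def
  by (intro conjI allI linearI)
    (simp_all add: sch_def algebra_simps sum.distrib scaleR_sum_right)

text \<open>The products of vectors span, so a bilinear map is determined by its values on them.\<close>

lemma schouten_eq: "schouten br = sch"
  unfolding schouten_def
proof (rule the_equality)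
  show "bilinear sch \<and> (\<forall>as bs. sch (wedge as) (wedge bs) = (\<Sum>i<length as. \<Sum>j<length bs.
     (-1) ^ (i + j) *\<^sub>R wedge (br (as ! i) (bs ! j) # omit i as @ omit j bs)))"
    using bilinear_sch sch_wedge by blast
  fix S assume S: "bilinear S \<and> (\<forall>as bs. S (wedge as) (wedge bs) = (\<Sum>i<length as. \<Sum>j<length bs.
     (-1) ^ (i + j) *\<^sub>R wedge (br (as ! i) (bs ! j) # omit i as @ omit j bs)))"
  then have lin: "linear (S X)" "linear (\<lambda>X. S X Y)" for X Y
    unfolding bilinear_def by auto
  have lin': "linear (sch X)" "linear (\<lambda>X. sch X Y)" for X Y
    using bilinear_sch unfolding bilinear_def by auto
  have wedges: "S (wedge as) (wedge bs) = sch (wedge as) (wedge bs)" for as bs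
    using S sch_wedge[of as bs] by simp
  have "S (wedge as) Y = sch (wedge as) Y" for as Y
    by (rule eq_on_wedge[OF lin(1) lin'(1) wedges])
  then have "S X Y = sch X Y" for X Y
    by (rule eq_on_wedge[OF lin(2) lin'(2)])
  then show "S = sch" by blast
qed

lemma sch_gbar: "sch X Y \<in> gbar"
  unfolding sch_def by (intro subspace_sum subspace_scale subspace_gbar elt_gbar)

subsection \<open>Identification of the chain space with the model\<close>

text \<open>The action of an element of \<open>gbar\<close> on the model, linear in both arguments.\<close>

definition act :: "'a ext \<Rightarrow> (cell \<Rightarrow>\<^sub>0 real) \<Rightarrow> (cell \<Rightarrow>\<^sub>0 real)" where
  "act X x = (\<Sum>l\<in>UNIV. coord l X *\<^sub>R mult l x)"

lemma act_simps [simp]: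
  "act (X + Y) x = act X x + act Y x" "act (k *\<^sub>R X) x = k *\<^sub>R act X x"
  "act X (x + y) = act X x + act X y" "act X (k *\<^sub>R x) = k *\<^sub>R act X x"
  by (simp_all add: act_def algebra_simps sum.distrib scaleR_sum_right)

lemma act_elt [simp]: "act (elt l) x = mult l x"
  unfolding act_def coord_elt by (cases l) (simp_all add: sum_letter)

lemma linear_act: "linear (\<lambda>X. act X x)" "linear (act X)"
  by (rule linearI; simp)+

lemma act_swap:
  assumes "X \<in> grd x" "Y \<in> grd y"
  shows "act X (act Y v) + (- 1) ^ (x * y) *\<^sub>R act Y (act X v) = 0"
proof -
  have *: "coord l X * coord l' Y * (- 1) ^ (grade l * grade l') = coord l X * coord l' Y * (- 1) ^ (x * y)"
    for l l'
    using grd_coord[OF assms(1), of l] grd_coord[OF assms(2), of l'] by auto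
  have "act X (act Y v) = (\<Sum>l\<in>UNIV. \<Sum>l'\<in>UNIV. (coord l X * coord l' Y) *\<^sub>R mult l (mult l' v))"
    by (simp add: act_def linear_sum[OF linear_mult] scaleR_sum_right)
  also have "\<dots> = (\<Sum>l\<in>UNIV. \<Sum>l'\<in>UNIV. - (coord l X * coord l' Y * (- 1) ^ (grade l * grade l')) *\<^sub>R mult l' (mult l v))"
    by (intro sum.cong refl) (subst mult_commute_sign, simp)
  also have "\<dots> = - ((- 1) ^ (x * y)) *\<^sub>R (\<Sum>l\<in>UNIV. \<Sum>l'\<in>UNIV. (coord l X * coord l' Y) *\<^sub>R mult l' (mult l v))"
    unfolding * by (simp add: scaleR_sum_right sum_negf mult_ac)
  also have "(\<Sum>l\<in>UNIV. \<Sum>l'\<in>UNIV. (coord l X * coord l' Y) *\<^sub>R mult l' (mult l v)) = act Y (act X v)"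
    by (subst sum.swap) (simp add: act_def linear_sum[OF linear_mult] scaleR_sum_right mult_ac)
  finally show ?thesis by simp
qed

abbreviation unit_cell :: cell where "unit_cell \<equiv> Cell False False False False 0 0 0"

definition phi_word :: "'a ext list \<Rightarrow> (cell \<Rightarrow>\<^sub>0 real)" where
  "phi_word Ys = (if set Ys \<subseteq> gbar then foldr act Ys (unit_vec unit_cell) else 0)"

lemma foldr_act_linear: "linear (foldr act u)"
proof (induction u)
  case Nil then show ?case by (simp add: linear_id[unfolded id_def])
next
  case (Cons a u)
  then show ?case using linear_compose[OF Cons linear_act(2)[of a]] by (simp add: comp_def)
qed

lemma chain_form_phi_word: "chain_form phi_word"
  unfolding chain_form_def
proof (intro conjI allI impI)
  fix u v Ys and X Y :: "'a ext" and c :: real and x y :: nat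
  show "phi_word Ys = 0" if "\<not> set Ys \<subseteq> gbar" using that by (simp add: phi_word_def)
  show "phi_word (u @ (X + Y) # v) = phi_word (u @ X # v) + phi_word (u @ Y # v)"
    if "X \<in> gbar" "Y \<in> gbar"
    using that subspace_add[OF subspace_gbar that]
    by (simp add: phi_word_def linear_add[OF foldr_act_linear])
  show "phi_word (u @ (c *\<^sub>R X) # v) = c *\<^sub>R phi_word (u @ X # v)" if "X \<in> gbar"
    using that subspace_scale[OF subspace_gbar that, of c]
    by (simp add: phi_word_def linear_scale[OF foldr_act_linear])
  assume XY: "X \<in> grd x" "Y \<in> grd y"
  have "X \<in> gbar" "Y \<in> gbar" using XY grd_gbar by auto
  moreover have "foldr act u (act X (act Y m)) + (- 1) ^ (x * y) *\<^sub>R foldr act u (act Y (act X m)) = 0" for m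
  proof -
    have "foldr act u (act X (act Y m)) + (- 1) ^ (x * y) *\<^sub>R foldr act u (act Y (act X m))
      = foldr act u (act X (act Y m) + (- 1) ^ (x * y) *\<^sub>R act Y (act X m))"
      by (simp add: linear_add[OF foldr_act_linear] linear_scale[OF foldr_act_linear])
    also have "\<dots> = 0" unfolding act_swap[OF XY] by (rule linear_0[OF foldr_act_linear])
    finally show ?thesis .
  qed
  ultimately show "phi_word (u @ X # Y # v) + (- 1) ^ (x * y) *\<^sub>R phi_word (u @ Y # X # v) = 0"
    by (simp add: phi_word_def)
qed

definition phi :: "'a chain \<Rightarrow> (cell \<Rightarrow>\<^sub>0 real)" where
  "phi = chainq.lift phi_word"

lemma phi_tri: "phi (tri Ys) = phi_word Ys"
  unfolding phi_def by (rule lift_tri[OF chain_form_phi_word])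

lemma linear_phi: "linear phi"
  unfolding phi_def by (rule linear_chain_lift[OF chain_form_phi_word])

lemmas phi_simps [simp] =
  linear_add[OF linear_phi] linear_diff[OF linear_phi] linear_scale[OF linear_phi]
  linear_neg[OF linear_phi] linear_0[OF linear_phi] linear_sum[OF linear_phi]

lemma phi_prep:
  assumes "X \<in> gbar" shows "phi (prep X c) = act X (phi c)"
proof (rule eq_on_tri[where c = c])
  show "linear (\<lambda>c. phi (prep X c))" "linear (\<lambda>c. act X (phi c))"
    by (rule linearI; simp)+
  show "phi (prep X (tri Ys)) = act X (phi (tri Ys))" for Ys
    using assms linear_0[OF linear_act(2)[of X]] by (auto simp: phi_tri phi_word_def)
qed

abbreviation P :: "letter \<Rightarrow> 'a chain \<Rightarrow> 'a chain" where "P l \<equiv> prep (elt l)"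

lemma phi_P [simp]: "phi (P l c) = mult l (phi c)"
  by (simp add: phi_prep elt_gbar)

lemma P_swap: "P l (P l' c) = - ((- 1) ^ (grade l * grade l')) *\<^sub>R P l' (P l c)"
  by (rule prep_swap[OF elt_grd elt_grd])

definition P_if :: "bool \<Rightarrow> letter \<Rightarrow> 'a chain \<Rightarrow> 'a chain" where
  "P_if s l c = (if s then P l c else c)"

text \<open>The exponents of the \<open>u\<^sub>i\<close> become iterations of left multiplications.\<close>

fun mon :: "cell \<Rightarrow> 'a chain" where
  "mon (Cell r p q e a b c) = P_if r Z3 (P_if p Z1 (P_if q Z2 (P_if e V
     ((P U1 ^^ a) ((P U2 ^^ b) ((P U3 ^^ c) (tri [])))))))"

definition psi :: "(cell \<Rightarrow>\<^sub>0 real) \<Rightarrow> 'a chain" where "psi = lin_ext mon"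

lemma linear_psi: "linear psi" unfolding psi_def by (rule linear_lin_ext)

lemmas psi_simps [simp] =
  linear_add[OF linear_psi] linear_diff[OF linear_psi] linear_scale[OF linear_psi]
  linear_neg[OF linear_psi] linear_0[OF linear_psi] linear_sum[OF linear_psi]

lemma psi_unit_vec [simp]: "psi (unit_vec i) = mon i"
  by (simp add: psi_def)

text \<open>An element of even grade anticommutes with itself.\<close>

lemma P_square: "P Z3 (P Z3 c) = 0" "P Z1 (P Z1 c) = 0" "P Z2 (P Z2 c) = 0" "P V (P V c) = 0"
proof -
  have zero: "x = - x \<Longrightarrow> x = 0" for x :: "'a chain"
    by (metis add.right_inverse scaleR_2 scaleR_eq_0_iff zero_neq_numeral)
  show "P Z3 (P Z3 c) = 0" "P Z1 (P Z1 c) = 0" "P Z2 (P Z2 c) = 0" "P V (P V c) = 0"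
    using P_swap[of Z3 Z3 c] P_swap[of Z1 Z1 c] P_swap[of Z2 Z2 c] P_swap[of V V c]
    by (auto intro!: zero)
qed

text \<open>Instances of \<open>P_swap\<close> that move a letter to its place in the normal order and thus terminate as
  rewrite rules.\<close>

lemma P_sort:
  "P Z1 (P Z3 c) = - P Z3 (P Z1 c)"
  "P Z2 (P Z3 c) = - P Z3 (P Z2 c)" "P Z2 (P Z1 c) = - P Z1 (P Z2 c)"
  "P V (P Z3 c) = - P Z3 (P V c)" "P V (P Z1 c) = - P Z1 (P V c)" "P V (P Z2 c) = - P Z2 (P V c)"
  "P U1 (P Z3 c) = - P Z3 (P U1 c)" "P U1 (P Z1 c) = - P Z1 (P U1 c)" "P U1 (P Z2 c) = - P Z2 (P U1 c)"
  "P U1 (P V c) = - P V (P U1 c)"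
  "P U2 (P Z3 c) = - P Z3 (P U2 c)" "P U2 (P Z1 c) = - P Z1 (P U2 c)" "P U2 (P Z2 c) = - P Z2 (P U2 c)"
  "P U2 (P V c) = - P V (P U2 c)" "P U2 (P U1 c) = P U1 (P U2 c)"
  "P U3 (P Z3 c) = - P Z3 (P U3 c)" "P U3 (P Z1 c) = - P Z1 (P U3 c)" "P U3 (P Z2 c) = - P Z2 (P U3 c)"
  "P U3 (P V c) = - P V (P U3 c)" "P U3 (P U1 c) = P U1 (P U3 c)" "P U3 (P U2 c) = P U2 (P U3 c)"
  by (subst P_swap, simp)+

lemma P_funpow:
  "P U2 ((P U1 ^^ n) c) = (P U1 ^^ n) (P U2 c)"
  "P U3 ((P U1 ^^ n) c) = (P U1 ^^ n) (P U3 c)"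
  "P U3 ((P U2 ^^ n) c) = (P U2 ^^ n) (P U3 c)"
  by (induction n) (simp_all add: P_sort)

text \<open>This says that \<open>mult_cell\<close> is the correct sorting rule in the chain space.\<close>

lemma psi_mult: "psi (mult l x) = P l (psi x)"
proof (rule linear_eq_on_unit_vec[where p = x])
  show "linear (\<lambda>x. psi (mult l x))" "linear (\<lambda>x. P l (psi x))"
    by (rule linearI; simp)+
  fix i
  show "psi (mult l (unit_vec i)) = P l (psi (unit_vec i))"
  proof (cases i)
    case (Cell r p q e a b c)
    show ?thesis unfolding Cell
      by (cases l; cases r; cases p; cases q; cases e;
          simp add: P_if_def P_square P_sort P_funpow)
  qed
qed

lemma psi_act: "X \<in> gbar \<Longrightarrow> psi (act X x) = prep X (psi x)"
proof -
  assume X: "X \<in> gbar"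
  have "prep X c = (\<Sum>l\<in>UNIV. coord l X *\<^sub>R P l c)" for c
  proof (rule eq_on_tri[where c = c])
    show "linear (prep X)" by (rule linear_prep)
    show "linear (\<lambda>c. \<Sum>l\<in>UNIV. coord l X *\<^sub>R P l c)"
      by (rule linearI) (simp_all add: algebra_simps sum.distrib scaleR_sum_right)
    fix Ys
    have add: "tri ((\<Sum>l\<in>S. f l *\<^sub>R elt l) # Ys) = (\<Sum>l\<in>S. f l *\<^sub>R tri (elt l # Ys))"
      if "finite S" for S and f :: "letter \<Rightarrow> real"
      using that
    proof (induction S)
      case empty
      show ?case using tri_Cons_scale[of 0 0 Ys] subspace_0[OF subspace_gbar] by simp
    next
      case (insert l S)
      have "(\<Sum>l\<in>S. f l *\<^sub>R elt l) \<in> gbar" "f l *\<^sub>R elt l \<in> gbar"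
        by (intro subspace_sum subspace_scale subspace_gbar elt_gbar)+
      then show ?case using insert by (simp add: tri_Cons_add tri_Cons_scale elt_gbar)
    qed
    show "prep X (tri Ys) = (\<Sum>l\<in>UNIV. coord l X *\<^sub>R P l (tri Ys))"
      using gbar_expand[OF X] add[of UNIV "\<lambda>l. coord l X"] by simp
  qed
  then show ?thesis by (simp add: act_def psi_mult)
qed

text \<open>A word is built up by left multiplications, which \<open>psi\<close> carries over from the model.\<close>

lemma psi_phi: "psi (phi c) = c"
proof (rule eq_on_tri[where c = c])
  show "linear (\<lambda>c. psi (phi c))" by (rule linearI) simp_all
  show "linear (\<lambda>c. c :: 'a chain)" by (rule linear_id[unfolded id_def])
  fix Ys :: "'a ext list"
  show "psi (phi (tri Ys)) = tri Ys"
  proof (cases "set Ys \<subseteq> gbar")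
    case True
    then have "psi (foldr act Ys (unit_vec unit_cell)) = tri Ys"
      by (induction Ys) (simp_all add: P_if_def psi_act)
    then show ?thesis using True by (simp add: phi_tri phi_word_def)
  qed (simp add: phi_tri phi_word_def tri_outside)
qed

lemma phi_funpow: "phi ((P l ^^ n) c) = (mult l ^^ n) (phi c)"
  by (induction n) simp_all

lemma mult_funpow:
  "(mult U3 ^^ n) (cvec False False False False 0 0 c) = cvec False False False False 0 0 (n + c)"
  "(mult U2 ^^ n) (cvec False False False False 0 b c) = cvec False False False False 0 (n + b) c"
  "(mult U1 ^^ n) (cvec False False False False a b c) = cvec False False False False (n + a) b c"
  by (induction n) simp_all

text \<open>In particular the monomials are linearly independent in the chain space.\<close>

lemma phi_mon: "phi (mon i) = unit_vec i"
proof (cases i)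
  case (Cell r p q e a b c)
  have "phi (tri []) = unit_vec unit_cell" by (simp add: phi_tri phi_word_def)
  then have "phi ((P U1 ^^ a) ((P U2 ^^ b) ((P U3 ^^ c) (tri [])))) = cvec False False False False a b c"
    using mult_funpow(1)[of c 0] mult_funpow(2)[of b 0 c] mult_funpow(3)[of a 0 b c]
    by (simp add: phi_funpow)
  then show ?thesis unfolding Cell
    by (simp add: P_if_def)
qed

lemma phi_psi: "phi (psi x) = x"
  by (rule linear_eq_on_unit_vec[where p = x])
    (auto simp: phi_mon linear_id[unfolded id_def] intro!: linearI)

lemma inj_phi: "inj phi"
  by (rule inj_on_inverseI[of _ psi]) (simp add: psi_phi)

lemma mult_chains: "x \<in> chains m w \<Longrightarrow> mult l x \<in> chains (Suc m) (grade l + w)"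
  unfolding chains_def
proof (rule linear_image_span_subset[OF linear_mult])
  fix y assume "y \<in> unit_vec ` cells m w"
  then obtain i where i: "y = unit_vec i" "degree i = m" "weight i = w" by (auto simp: cells_def)
  show "mult l y \<in> span (unit_vec ` cells (Suc m) (grade l + w))"
  proof (cases i)
    case (Cell r p q e a b c)
    show ?thesis using i(2,3) unfolding i(1) Cell chains_def[symmetric] mult_unit_vec
      by (cases l)
        (auto intro!: subspace_scale[OF subspace_chains] unit_vec_in_chains subspace_0[OF subspace_chains])
  qed
qed

lemma act_chains:
  assumes "X \<in> grd y" "x \<in> chains m w"
  shows "act X x \<in> chains (Suc m) (y + w)"
  unfolding act_def
proof (intro subspace_sum subspace_chains)
  fix l
  show "coord l X *\<^sub>R mult l x \<in> chains (Suc m) (y + w)"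
  proof (cases "grade l = y")
    case True
    then show ?thesis using mult_chains[OF assms(2), of l] by (simp add: subspace_scale[OF subspace_chains])
  qed (simp add: grd_coord[OF assms(1)] subspace_0[OF subspace_chains])
qed

lemma has_grades_gbar: "has_grades Ys ys \<Longrightarrow> set Ys \<subseteq> gbar"
proof -
  assume "has_grades Ys ys"
  then show "set Ys \<subseteq> gbar"
    unfolding has_grades_def
    by (induction rule: list_all2_induct) (use grd_gbar in auto)
qed

lemma phi_tri_chains: "has_grades Ys ys \<Longrightarrow> phi (tri Ys) \<in> chains (length Ys) (sum_list ys)"
proof -
  assume g: "has_grades Ys ys"
  have "foldr act Ys (unit_vec unit_cell) \<in> chains (length Ys) (sum_list ys)"
    using g unfolding has_grades_def
    by (induction rule: list_all2_induct) (auto intro: act_chains unit_vec_in_chains)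
  then show ?thesis using has_grades_gbar[OF g] by (simp add: phi_tri phi_word_def)
qed

lemma P_chain_space: "c \<in> chain_space m w \<Longrightarrow> P l c \<in> chain_space (Suc m) (grade l + w)"
  unfolding chain_space_def
proof (rule linear_image_span_subset[OF linear_prep])
  fix y assume "y \<in> {tri Ys |(Ys :: 'a ext list) ys. length Ys = m \<and> has_grades Ys ys \<and> sum_list ys = w}"
  then obtain Ys ys where "y = tri Ys" "length Ys = m" "has_grades Ys ys" "sum_list ys = w" by blast
  then have "P l y = tri (elt l # Ys)" "length (elt l # Ys) = Suc m"
    "has_grades (elt l # Ys) (grade l # ys)" "sum_list (grade l # ys) = grade l + w"
    by (auto simp: has_grades_def elt_grd)
  then show "P l y \<in> span {tri Ys |(Ys :: 'a ext list) ys. length Ys = Suc m \<and> has_grades Ys ys \<and> sum_list ys = grade l + w}"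
    by (intro span_base) blast
qed

lemma mon_chain_space: "mon i \<in> chain_space (degree i) (weight i)"
proof (cases i)
  case (Cell r p q e a b c)
  have one: "tri [] \<in> (chain_space 0 0 :: 'a chain set)"
    unfolding chain_space_def by (rule span_base) (auto simp: has_grades_def)
  have pow: "x \<in> chain_space m w \<Longrightarrow> (P l ^^ n) x \<in> chain_space (n + m) (n * grade l + w)" for x m w l n
    by (induction n) (use P_chain_space in \<open>auto simp: add.assoc\<close>)
  have opt: "x \<in> chain_space m w \<Longrightarrow> P_if s l x \<in> chain_space (of_bool s + m) (of_bool s * grade l + w)" for x m w s l
    using P_chain_space[of x m w l] by (simp add: P_if_def)
  have "mon i \<in> chain_space (of_bool r + (of_bool p + (of_bool q + (of_bool e + (a + (b + (c + 0)))))))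
    (of_bool r * grade Z3 + (of_bool p * grade Z1 + (of_bool q * grade Z2 + (of_bool e * grade V +
      (a * grade U1 + (b * grade U2 + (c * grade U3 + 0)))))))"
    unfolding Cell mon.simps by (intro opt pow one)
  then show ?thesis unfolding Cell by (simp add: add.assoc mult.commute)
qed

lemma phi_chain_space: "phi ` chain_space m w = chains m w"
proof
  show "phi ` chain_space m w \<subseteq> chains m w"
    unfolding chain_space_def linear_span_image[OF linear_phi, symmetric]
    by (rule span_minimal) (use phi_tri_chains subspace_chains in auto)
  show "chains m w \<subseteq> phi ` chain_space m w"
    unfolding chains_def
  proof (rule span_minimal)
    show "unit_vec ` cells m w \<subseteq> phi ` chain_space m w"
    proof
      fix x assume "x \<in> unit_vec ` cells m w"
      then obtain i where "x = unit_vec i" "degree i = m" "weight i = w" by (auto simp: cells_def)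
      then show "x \<in> phi ` chain_space m w" using mon_chain_space[of i] phi_mon[of i] by force
    qed
    show "subspace (phi ` chain_space m w)"
      unfolding chain_space_def by (intro linear_subspace_image linear_phi) simp
  qed
qed

subsection \<open>The boundary operator\<close>

definition bdc :: "'a chain \<Rightarrow> 'a chain" where "bdc c = psi (bd (phi c))"

lemma linear_bdc: "linear bdc"
  by (rule linearI) (simp_all add: bdc_def)

lemmas bdc_simps [simp] =
  linear_add[OF linear_bdc] linear_diff[OF linear_bdc] linear_scale[OF linear_bdc]
  linear_neg[OF linear_bdc] linear_0[OF linear_bdc] linear_sum[OF linear_bdc]

lemma phi_bdc [simp]: "phi (bdc c) = bd (phi c)"
  by (simp add: bdc_def phi_psi)

definition adc :: "'a ext \<Rightarrow> 'a chain \<Rightarrow> 'a chain" where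
  "adc Y c = bdc (prep Y c) + prep Y (bdc c)"

lemma phi_adc:
  assumes "Y \<in> gbar" shows "phi (adc Y c) = (\<Sum>l\<in>UNIV. coord l Y *\<^sub>R adj l (phi c))"
  by (simp add: adc_def phi_prep[OF assms] act_def adj_def linear_sum[OF linear_bd]
    sum.distrib scaleR_right_distrib)

text \<open>The derivation rule \<open>adj_mult\<close> for general homogeneous elements, by expansion in the basis letters.\<close>

lemma adc_prep:
  assumes Y: "Y \<in> grd y" and X: "X \<in> grd x"
  shows "adc Y (prep X c) = prep (schouten br Y X) c + (- 1) ^ (y * x) *\<^sub>R prep X (adc Y c)"
proof -
  have gb: "Y \<in> gbar" "X \<in> gbar" using X Y grd_gbar by auto
  \<comment> \<open>Only letters of the same grade as \<open>Y\<close> and \<open>X\<close> contribute, so the signs agree.\<close>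
  have *: "coord l Y * coord l' X * (- 1) ^ (grade l * grade l') = coord l Y * coord l' X * (- 1) ^ (y * x)"
    for l l'
    using grd_coord[OF Y, of l] grd_coord[OF X, of l'] by auto
  let ?m = "phi c"
  have "phi (adc Y (prep X c)) = (\<Sum>l\<in>UNIV. coord l Y *\<^sub>R adj l (act X ?m))"
    by (simp add: phi_adc gb phi_prep)
  also have "\<dots> = (\<Sum>l\<in>UNIV. \<Sum>l'\<in>UNIV. (coord l Y * coord l' X) *\<^sub>R adj l (mult l' ?m))"
    by (simp add: act_def linear_sum[OF linear_adj] linear_scale[OF linear_adj] scaleR_sum_right)
  also have "\<dots> = (\<Sum>l\<in>UNIV. \<Sum>l'\<in>UNIV. (coord l Y * coord l' X * br_coeff l l') *\<^sub>R mult (br_letter l l') ?m)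
    + (\<Sum>l\<in>UNIV. \<Sum>l'\<in>UNIV. (coord l Y * coord l' X * (- 1) ^ (y * x)) *\<^sub>R mult l' (adj l ?m))"
    unfolding sum.distrib[symmetric] adj_mult *[symmetric]
    by (simp add: scaleR_right_distrib)
  also have "(\<Sum>l\<in>UNIV. \<Sum>l'\<in>UNIV. (coord l Y * coord l' X * br_coeff l l') *\<^sub>R mult (br_letter l l') ?m)
    = act (sch Y X) ?m"
    unfolding sch_def by (simp add: linear_sum[OF linear_act(1)])
  also have "(\<Sum>l\<in>UNIV. \<Sum>l'\<in>UNIV. (coord l Y * coord l' X * (- 1) ^ (y * x)) *\<^sub>R mult l' (adj l ?m))
    = (- 1) ^ (y * x) *\<^sub>R act X (\<Sum>l\<in>UNIV. coord l Y *\<^sub>R adj l ?m)"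
    unfolding act_def linear_sum[OF linear_mult] scaleR_sum_right
    by (subst sum.swap) (simp add: mult_ac)
  finally have "phi (adc Y (prep X c)) = phi (prep (schouten br Y X) c + (- 1) ^ (y * x) *\<^sub>R prep X (adc Y c))"
    by (simp add: phi_prep sch_gbar gb schouten_eq phi_adc)
  then show ?thesis by (rule injD[OF inj_phi])
qed

lemma adc_tri_Nil: "Y \<in> gbar \<Longrightarrow> adc Y (tri []) = 0"
proof -
  assume Y: "Y \<in> gbar"
  have "adj l (unit_vec unit_cell) = 0" for l
    by (cases l) (simp_all add: adj_def eig_def)
  then have "phi (adc Y (tri [])) = phi 0"
    unfolding phi_adc[OF Y] by (simp add: phi_tri phi_word_def)
  then show ?thesis using inj_phi by (simp only: inj_eq)
qed

text \<open>The factors \<open>(-1)\<^sup>y\<^sup>x\<close> of the derivation rule accumulate while \<open>Y\<close> moves to the position \<open>j\<close>.\<close>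

lemma adc_tri:
  assumes "Y \<in> grd y" "has_grades Xs xs"
  shows "adc Y (tri Xs) = (\<Sum>j<length Xs. (- 1) ^ (y * (\<Sum>s<j. xs ! s)) *\<^sub>R tri (Xs[j := schouten br Y (Xs ! j)]))"
  using assms(2) unfolding has_grades_def
proof (induction rule: list_all2_induct)
  case Nil
  show ?case using adc_tri_Nil assms(1) grd_gbar by auto
next
  case (Cons X Xs x xs)
  have "adc Y (tri (X # Xs)) = prep (schouten br Y X) (tri Xs) + (- 1) ^ (y * x) *\<^sub>R prep X (adc Y (tri Xs))"
    using adc_prep[OF assms(1) Cons(1), of "tri Xs"] by simp
  also have "\<dots> = (\<Sum>j<length (X # Xs). (- 1) ^ (y * (\<Sum>s<j. (x # xs) ! s)) *\<^sub>R tri ((X # Xs)[j := schouten br Y ((X # Xs) ! j)]))"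
    unfolding Cons.IH
    by (simp add: sum.lessThan_Suc_shift linear_sum[OF linear_prep] scaleR_sum_right distrib_left power_add
      del: sum.lessThan_Suc)
  finally show ?case .
qed

lemma omit_Cons: "omit 0 (x # xs) = xs" "omit (Suc i) (x # xs) = x # omit i xs"
  by (simp_all add: omit_def)

text \<open>In the sum for \<open>Y # Ys\<close>, the terms with \<open>i = 0\<close> form \<open>ad\<^sub>Y\<close> of the rest, and those with \<open>i > 0\<close>
  form \<open>- Y \<triangle> \<partial>\<close> of the rest: the shift of \<open>i\<close> by one accounts for the sign.\<close>

lemma bdc_tri:
  assumes "has_grades Ys ys"
  shows "bdc (tri Ys) = (\<Sum>j<length Ys. \<Sum>i<j.
          (-1) ^ (i + ys ! i * (\<Sum>s\<in>{i<..<j}. ys ! s)) *\<^sub>R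
            tri (omit i (Ys[j := schouten br (Ys ! i) (Ys ! j)])))"
  using assms unfolding has_grades_def
proof (induction rule: list_all2_induct)
  case Nil
  have "phi (bdc (tri [])) = phi 0" by (simp add: phi_tri phi_word_def)
  then have "bdc (tri []) = 0" using inj_phi by (simp only: inj_eq)
  then show ?case by simp
next
  case (Cons Y Ys y ys)
  have shift: "(\<Sum>s\<in>{Suc i<..<Suc j}. (y # ys) ! s) = (\<Sum>s\<in>{i<..<j}. ys ! s)" for i j
    by (rule sum.reindex_bij_witness[of _ Suc "\<lambda>s. s - 1"]) auto
  have shift0: "(\<Sum>s\<in>{0<..<Suc j}. (y # ys) ! s) = (\<Sum>s<j. ys ! s)" for j
    by (rule sum.reindex_bij_witness[of _ Suc "\<lambda>s. s - 1"]) auto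
  have "bdc (tri (Y # Ys)) = adc Y (tri Ys) - prep Y (bdc (tri Ys))"
    by (simp add: adc_def)
  also have "adc Y (tri Ys) = (\<Sum>j<length Ys. (- 1) ^ (y * (\<Sum>s<j. ys ! s)) *\<^sub>R tri (Ys[j := schouten br Y (Ys ! j)]))"
    by (rule adc_tri[OF Cons(1)]) (simp add: has_grades_def Cons)
  also have "\<dots> - prep Y (bdc (tri Ys)) = (\<Sum>j<length Ys. \<Sum>i<Suc j.
          (-1) ^ (i + (y # ys) ! i * (\<Sum>s\<in>{i<..<Suc j}. (y # ys) ! s)) *\<^sub>R
            tri (omit i ((Y # Ys)[Suc j := schouten br ((Y # Ys) ! i) ((Y # Ys) ! Suc j)])))"
    unfolding Cons.IH sum.lessThan_Suc_shift
    by (simp only: shift shift0 nth_Cons_0 nth_Cons_Suc list_update_code omit_Cons prep_simps prep_tri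
        sum.distrib sum_subtractf power_add power_0 power_Suc mult_1_left add_0_left
        linear_sum[OF linear_prep] sum_negf mult_minus_left scaleR_minus_left diff_conv_add_uminus add_Suc)
  also have "\<dots> = (\<Sum>j<length (Y # Ys). \<Sum>i<j.
          (-1) ^ (i + (y # ys) ! i * (\<Sum>s\<in>{i<..<j}. (y # ys) ! s)) *\<^sub>R
            tri (omit i ((Y # Ys)[j := schouten br ((Y # Ys) ! i) ((Y # Ys) ! j)])))"
    by (simp only: list.size add_Suc_right add_0_right sum.lessThan_Suc_shift[of _ "length Ys"]) simp
  finally show ?case .
qed

text \<open>Uniqueness holds because the monomials are products of homogeneous elements and span the chain
  space.\<close>

lemma boundary_eq: "boundary br = bdc"
  unfolding boundary_def
proof (rule the_equality)
  show "linear bdc \<and> (\<forall>Ys ys. has_grades Ys ys \<longrightarrow> bdc (tri Ys) = (\<Sum>j<length Ys. \<Sum>i<j.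
          (-1) ^ (i + ys ! i * (\<Sum>s\<in>{i<..<j}. ys ! s)) *\<^sub>R
            tri (omit i (Ys[j := schouten br (Ys ! i) (Ys ! j)]))))"
    using linear_bdc bdc_tri by blast
  fix D assume D: "linear D \<and> (\<forall>Ys ys. has_grades Ys ys \<longrightarrow> D (tri Ys) = (\<Sum>j<length Ys. \<Sum>i<j.
          (-1) ^ (i + ys ! i * (\<Sum>s\<in>{i<..<j}. ys ! s)) *\<^sub>R
            tri (omit i (Ys[j := schouten br (Ys ! i) (Ys ! j)]))))"
  show "D = bdc"
  proof
    fix c
    have "D x = bdc x" if "x \<in> chain_space m w" for x m w
      by (rule linear_eq_on[OF _ linear_bdc that[unfolded chain_space_def]])
        (use D bdc_tri in auto)
    then have mon: "D (mon i) = bdc (mon i)" for i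
      using mon_chain_space by blast
    have "D (psi (phi c)) = bdc (psi (phi c))"
    proof (rule linear_eq_on_unit_vec[where p = "phi c"])
      show "linear (\<lambda>x. D (psi x))" "linear (\<lambda>x. bdc (psi x))"
        using D by (auto intro!: linearI simp: linear_add linear_scale)
      show "D (psi (unit_vec i)) = bdc (psi (unit_vec i))" for i by (simp add: mon)
    qed
    then show "D c = bdc c" by (simp add: psi_phi)
  qed
qed

subsection \<open>Dimensions\<close>

lemma dim_chain_space: "dim (chain_space m w :: 'a chain set) = card (cells m w)"
  using dim_inj_linear_image[OF linear_phi inj_phi, of "chain_space m w"]
  by (simp add: phi_chain_space dim_chains)

lemma phi_cycles: "phi ` cycles br m w = {x \<in> chains m w. bd x = 0}"
proof -
  have "bdc c = 0 \<longleftrightarrow> bd (phi c) = 0" for c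
    using phi_bdc[of c] injD[OF inj_phi, of "bdc c" 0] by (auto simp del: phi_bdc)
  then show ?thesis
    unfolding cycles_def boundary_eq phi_chain_space[of m w, symmetric] by auto
qed

lemma dim_cycles: "dim (cycles br m w) = dim {x \<in> chains m w. bd x = 0}"
  using dim_inj_linear_image[OF linear_phi inj_phi, of "cycles br m w"] by (simp add: phi_cycles)

lemma phi_boundaries: "phi ` boundary br ` chain_space m w = bd ` chains m w"
  unfolding boundary_eq phi_chain_space[of m w, symmetric] by (auto simp: image_image)

text \<open>The isomorphism \<open>phi\<close> carries cycles and boundaries over, so the dimensions agree with those of the
  model.\<close>

lemma betti_eq:
  assumes "w > 0" shows "betti br m w = card (harm m w)"
proof -
  let ?U = "boundary br ` chain_space (m + 1) w" and ?V = "cycles br m w"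
  have sub: "subspace (chain_space k w :: 'a chain set)" for k by (simp add: chain_space_def)
  have lin: "linear (boundary br)" by (simp add: boundary_eq linear_bdc)
  have "phi ` ?U \<subseteq> phi ` ?V"
    unfolding phi_boundaries phi_cycles using bd_chains bd_bd by auto
  then have UV: "?U \<subseteq> ?V" using inj_phi by (meson inj_image_subset_iff)
  have "dim ?V = dim ?U + quot_dim ?V ?U"
  proof (rule dim_eq_quot_dim[OF _ _ UV])
    show "subspace ?U" by (intro linear_subspace_image lin sub)
    show "subspace ?V"
      using sub[of m] by (auto simp: cycles_def subspace_def linear_0[OF lin] linear_add[OF lin] linear_scale[OF lin])
    show "finite (mon ` cells m w)" by (simp add: finite_cells)
    show "?V \<subseteq> span (mon ` cells m w)"
    proof
      fix c assume "c \<in> ?V"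
      then have "phi c \<in> span (unit_vec ` cells m w)"
        using phi_cycles[of m w] by (auto simp: chains_def)
      then have "psi (phi c) \<in> span (mon ` cells m w)"
        by (rule linear_image_span_subset[OF linear_psi, rotated]) (auto intro: span_base)
      then show "c \<in> span (mon ` cells m w)" by (simp add: psi_phi)
    qed
  qed
  moreover have "dim ?V = dim (bd ` chains (Suc m) w) + card (harm m w)"
    by (simp add: dim_cycles dim_cycles_model[OF assms])
  moreover have "dim ?U = dim (bd ` chains (Suc m) w)"
    using dim_inj_linear_image[OF linear_phi inj_phi, of ?U] by (simp add: phi_boundaries)
  ultimately show ?thesis unfolding betti_def by simp
qed

end

section \<open>The table of dimensions\<close>

theorem theorem6p3:
  fixes br :: "'a::real_vector \<Rightarrow> 'a \<Rightarrow> 'a"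
    and z1 z2 z3 :: 'a
    and \<alpha> :: real
    and w \<kappa> :: nat
  assumes "\<alpha> \<noteq> 0"
    and "lie_bracket br"
    and "distinct [z1, z2, z3]"
    and "independent {z1, z2, z3}"
    and "span {z1, z2, z3} = (UNIV :: 'a set)"
    and "br z1 z2 = 0"
    and "br z1 z3 = z1"
    and "br z2 z3 = \<alpha> *\<^sub>R z2"
    and "\<kappa> = (if \<alpha> = -1 then 1 else 0)"
    and "w > 0"
  shows
    "dim (chain_space (w - 1) w :: 'a chain set) = w choose 2 \<and>
     dim (cycles br (w - 1) w) = w choose 2 \<and>
     betti br (w - 1) w = 0 \<and>
     dim (chain_space w w :: 'a chain set) = 3 * (w choose 2) + (w + 2 choose 2) \<and>
     dim (cycles br w w) = 2 * (w choose 2) + (w + 2 choose 2) \<and>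
     betti br w w = 0 \<and>
     dim (chain_space (w + 1) w :: 'a chain set) = 3 * (w choose 2) + 3 * (w + 2 choose 2) \<and>
     dim (cycles br (w + 1) w) = (w choose 2) + 2 * (w + 2 choose 2) \<and>
     betti br (w + 1) w = \<kappa> \<and>
     dim (chain_space (w + 2) w :: 'a chain set) = (w choose 2) + 3 * (w + 2 choose 2) \<and>
     dim (cycles br (w + 2) w) = (w + 2 choose 2) + \<kappa> \<and>
     betti br (w + 2) w = 2 * \<kappa> \<and>
     dim (chain_space (w + 3) w :: 'a chain set) = (w + 2 choose 2) \<and>
     dim (cycles br (w + 3) w) = \<kappa> \<and>
     betti br (w + 3) w = \<kappa>"
proof -
  interpret lie3 \<alpha> br z1 z2 z3
    using assms(1-8) by unfold_locales
  define C where "C m = card (cells m w)" for m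
  define Z where "Z m = dim {x \<in> chains m w. bd x = 0}" for m
  define B where "B m = dim (bd ` chains m w)" for m
  have rank: "C m = Z m + B m" for m
    unfolding C_def Z_def B_def using dim_chains_rank_nullity[of m w] by (simp add: dim_chains)
  have homology: "Z m = B (Suc m) + card (harm m w)" for m
    unfolding Z_def B_def by (rule dim_cycles_model[OF assms(10)])
  have C: "C (w - 1) = w choose 2" "C w = 3 * (w choose 2) + (w + 2 choose 2)"
    "C (w + 1) = 3 * (w choose 2) + 3 * (w + 2 choose 2)"
    "C (w + 2) = (w choose 2) + 3 * (w + 2 choose 2)" "C (w + 3) = (w + 2 choose 2)" "C (w + 4) = 0"
    unfolding C_def
    using card_cells[of "w - 1" w 0] card_cells[of w w 1] card_cells[of "w + 1" w 2]
      card_cells[of "w + 2" w 3] card_cells[of "w + 3" w 4] card_cells[of "w + 4" w 5] assms(10)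
    by (simp_all add: numeral_2_eq_2 numeral_3_eq_3 binomial_eq_0)
  have harm0: "card (harm (w - 1) w) = 0"
    using assms(10) by (cases w) (simp_all add: card_harm)
  have harm: "card (harm w w) = 0" "card (harm (w + 1) w) = \<kappa>"
    "card (harm (w + 2) w) = 2 * \<kappa>" "card (harm (w + 3) w) = \<kappa>"
    using assms(9) by (simp_all add: card_harm[OF assms(10)])
  \<comment> \<open>There are no chains of degree \<open>w + 4\<close>; from here \<open>rank\<close> and \<open>homology\<close> determine everything downwards.\<close>
  have "B (w + 4) = 0" using rank[of "w + 4"] C(6) by linarith
  then have Z3: "Z (w + 3) = \<kappa>" and B3: "B (w + 3) + \<kappa> = (w + 2 choose 2)"
    using homology[of "w + 3"] rank[of "w + 3"] C(5) harm(4) by (simp_all add: numeral_eq_Suc)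
  then have Z2: "Z (w + 2) = (w + 2 choose 2) + \<kappa>"
    and B2: "B (w + 2) + \<kappa> = (w choose 2) + 2 * (w + 2 choose 2)"
    using homology[of "w + 2"] rank[of "w + 2"] C(4) harm(3) by (simp_all add: numeral_eq_Suc)
  then have Z1: "Z (w + 1) = (w choose 2) + 2 * (w + 2 choose 2)"
    and B1: "B (w + 1) = 2 * (w choose 2) + (w + 2 choose 2)"
    using homology[of "w + 1"] rank[of "w + 1"] C(3) harm(2) by (simp_all add: numeral_eq_Suc)
  then have Z0: "Z w = 2 * (w choose 2) + (w + 2 choose 2)" and B0: "B w = w choose 2"
    using homology[of w] rank[of w] C(2) harm(1) by simp_all
  then have Zm: "Z (w - 1) = w choose 2"
    using homology[of "w - 1"] harm0 assms(10) by simp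
  show ?thesis
    using C harm0 harm Z3 Z2 Z1 Z0 Zm
    by (simp add: dim_chain_space dim_cycles betti_eq[OF assms(10)] C_def[symmetric] Z_def[symmetric])
qed

end
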